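(* Let $\Omega=[a_1,b_1)\cup[a_2,b_2)\cup[a_3,b_3)\subset\mathbb{R}$ be spectral, where the displayed bounded intervals are the three pairwise disjoint interval components of $\Omega$. Let $\ell_j=b_j-a_j>0$ and $L=\ell_1+\ell_2+\ell_3$. Then, after relabeling the three interval components if necessary, at least one of the following holds: (i) $\Omega$ is a fundamental domain for the lattice $L\mathbb{Z}$. (ii) $\ell_1=\ell_2=\ell_3=h=L/3$. Equivalently, each component is a fundamental domain for $h\mathbb{Z}$, and $\Omega$ is a three-fold lattice multitile by $h\mathbb{Z}$. (iii) $\ell_3=\ell_1+\ell_2=h=L/2$ and $b_1\equiv a_2 \pmod{h\mathbb{Z}}$. On the circle $\mathbb{R}/h\mathbb{Z}$, the images of $[a_1,b_1)$ and $[a_2,b_2)$ are adjacent half-open arcs that partition the circle, while $[a_3,b_3)$ is a fundamental domain for $h\mathbb{Z}$. Consequently, $\Omega$ is a two-fold lattice multitile by $h\mathbb{Z}$.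
   Context: A bounded measurable set $\Omega\subset\mathbb{R}$ of positive Lebesgue measure $|\Omega|$ is called spectral if there is a set $\Lambda\subset\mathbb{R}$ such that $\{|\Omega|^{-1/2}e^{2\pi i\lambda x}:\lambda\in\Lambda\}$ is an orthonormal basis of $L^2(\Omega)$. For $h>0$ and a positive integer $k$, a bounded measurable set $E\subset\mathbb{R}$ is a $k$-fold lattice multitile by $h\mathbb{Z}$ if $\sum_{n\in\mathbb{Z}}\mathbf{1}_E(x+nh)=k$ for almost every $x\in\mathbb{R}$. It is a fundamental domain for $h\mathbb{Z}$ if this holds with $k=1$. All tiling, fundamental-domain and partition statements are understood up to Lebesgue-null sets. Saying that the intervals are the components of $\Omega$ means that they are the distinct positive-length interval components (adjacent intervals are considered merged). *)

theory Defs
  imports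
    "HOL-Analysis.Analysis"
    "HOL-Combinatorics.Permutations"
    "HOL-Library.Real_Mod"
begin

section \<open>The space $L^2(S)$ and orthonormal bases\<close>

text \<open>Elements of $L^2(S)$ are represented by functions on all of the real line; only their
  restriction to \<open>S\<close>, modulo null sets, matters below.\<close>

definition L2_on :: "real set \<Rightarrow> (real \<Rightarrow> complex) \<Rightarrow> bool" where
  "L2_on S f \<longleftrightarrow>
     f \<in> borel_measurable (lebesgue_on S) \<and>
     integrable (lebesgue_on S) (\<lambda>x. (cmod (f x))\<^sup>2)"

definition L2_inner_on :: "real set \<Rightarrow> (real \<Rightarrow> complex) \<Rightarrow> (real \<Rightarrow> complex) \<Rightarrow> complex" where
  "L2_inner_on S f g = (LINT x|lebesgue_on S. f x * cnj (g x))"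

definition L2_norm_on :: "real set \<Rightarrow> (real \<Rightarrow> complex) \<Rightarrow> real" where
  "L2_norm_on S f = sqrt (LINT x|lebesgue_on S. (cmod (f x))\<^sup>2)"

text \<open>The last conjunct says that the finite linear combinations of the family are dense.\<close>

definition L2_orthonormal_basis ::
    "real set \<Rightarrow> 'i set \<Rightarrow> ('i \<Rightarrow> real \<Rightarrow> complex) \<Rightarrow> bool" where
  "L2_orthonormal_basis S I e \<longleftrightarrow>
     (\<forall>i\<in>I. L2_on S (e i)) \<and>
     (\<forall>i\<in>I. \<forall>j\<in>I. L2_inner_on S (e i) (e j) = (if i = j then 1 else 0)) \<and>
     (\<forall>f. L2_on S f \<longrightarrow>
        (\<forall>\<epsilon>>0. \<exists>J c. finite J \<and> J \<subseteq> I \<and>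
           L2_norm_on S (\<lambda>x. f x - (\<Sum>i\<in>J. c i * e i x)) < \<epsilon>))"

section \<open>Spectral sets\<close>

definition spectral :: "real set \<Rightarrow> bool" where
  "spectral \<Omega> \<longleftrightarrow>
     bounded \<Omega> \<and> \<Omega> \<in> sets lebesgue \<and> measure lebesgue \<Omega> > 0 \<and>
     (\<exists>\<Lambda>::real set. L2_orthonormal_basis \<Omega> \<Lambda>
        (\<lambda>\<xi> x. of_real (measure lebesgue \<Omega> powr (-1/2)) *
                 exp (2 * of_real pi * \<i> * of_real \<xi> * of_real x)))"

section \<open>Lattice multitiles\<close>

definition lattice_multitile :: "nat \<Rightarrow> real set \<Rightarrow> real \<Rightarrow> bool" where
  "lattice_multitile k E h \<longleftrightarrow>
     h > 0 \<and> k > 0 \<and> bounded E \<and> E \<in> sets lebesgue \<and>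
     (AE x in lebesgue.
        ((\<lambda>n::int. indicator E (x + of_int n * h) :: real) has_sum of_nat k) UNIV)"

definition fundamental_domain :: "real set \<Rightarrow> real \<Rightarrow> bool" where
  "fundamental_domain E h \<longleftrightarrow> lattice_multitile 1 E h"

section \<open>The circle as a quotient of the real line\<close>

definition circle_proj :: "real \<Rightarrow> real \<Rightarrow> real set" where
  "circle_proj h x = {y. [x = y] (rmod h)}"

definition circle :: "real \<Rightarrow> real set set" where
  "circle h = range (circle_proj h)"

definition circle_null :: "real \<Rightarrow> real set set \<Rightarrow> bool" where
  "circle_null h N \<longleftrightarrow> {x. circle_proj h x \<in> N} \<in> null_sets lebesgue"

text \<open>Two proper half-open arcs, \<open>B\<close> beginning where \<open>A\<close> ends; the bound \<open>w \<le> u + h\<close>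
  says that going along \<open>A\<close> and then \<open>B\<close> makes at most one full turn, so they do not overlap.\<close>

definition adjacent_half_open_arcs :: "real \<Rightarrow> real set set \<Rightarrow> real set set \<Rightarrow> bool" where
  "adjacent_half_open_arcs h A B \<longleftrightarrow>
     (\<exists>u v w. u < v \<and> v < w \<and> w \<le> u + h \<and>
        A = circle_proj h ` {u..<v} \<and> B = circle_proj h ` {v..<w})"

text \<open>Partition statements are understood up to null sets.\<close>

definition partition_circle :: "real \<Rightarrow> real set set \<Rightarrow> real set set \<Rightarrow> bool" where
  "partition_circle h A B \<longleftrightarrow>
     A \<subseteq> circle h \<and> B \<subseteq> circle h \<and>
     circle_null h (A \<inter> B) \<and> circle_null h (circle h - (A \<union> B))"

end

theory Submission
  imports Defs
begin

text \<open>Let \<open>v(\<xi>)\<close> and \<open>w(\<xi>)\<close> be the values of the exponential with frequency \<open>\<xi>\<close> at the left and at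
  the right end points of the intervals. Orthogonality means that the Gram matrices of \<open>v\<close> and \<open>w\<close>
  over the spectrum agree, so \<open>w = B v\<close> with a unitary boundary matrix \<open>B\<close>. Parseval's identity for
  indicator functions of two short intervals yields a weighted mean over the spectrum that kills
  the character \<open>s\<close> for any finitely many prescribed nonzero differences \<open>s\<close> of points of \<open>\<Omega>\<close>. This
  mean recovers \<open>B j k\<close> from \<open>b j - a k\<close> alone; in particular a diagonal entry vanishes whenever
  some other interval is longer.

  Order the three intervals by length. Unless all lengths agree, the diagonal entries of the two
  shorter ones vanish, hence by unitarity one of these two rows has a single nonzero entry. The
  remaining two rows either permute the intervals cyclically, and the spectrum lies in a coset of
  the dual lattice of \<open>L\<int>\<close>, or mix two values whose quotient, being forced to be perpendicular to a
  fixed direction, takes only two opposite values; then the means determine all lengths.\<close>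

section \<open>Parseval's identity\<close>

lemma L2_on_mult_integrable:
  assumes f: "L2_on S f" and g: "L2_on S g"
  shows "integrable (lebesgue_on S) (\<lambda>x. f x * cnj (g x))"
proof (rule Bochner_Integration.integrable_bound)
  show "integrable (lebesgue_on S) (\<lambda>x. (cmod (f x))\<^sup>2 + (cmod (g x))\<^sup>2)"
    using f g unfolding L2_on_def by auto
  have [measurable]: "f \<in> borel_measurable (lebesgue_on S)" "g \<in> borel_measurable (lebesgue_on S)"
    using f g unfolding L2_on_def by auto
  have [measurable]: "cnj \<in> borel_measurable borel"
    by (intro borel_measurable_continuous_onI continuous_intros)
  show "(\<lambda>x. f x * cnj (g x)) \<in> borel_measurable (lebesgue_on S)"
    by measurable
  have "u * v \<le> u\<^sup>2 + v\<^sup>2" if "u \<ge> 0" "v \<ge> 0" for u v :: real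
    using sum_squares_bound[of u v] mult_nonneg_nonneg[OF that] by linarith
  then show "AE x in lebesgue_on S. norm (f x * cnj (g x)) \<le> norm ((cmod (f x))\<^sup>2 + (cmod (g x))\<^sup>2)"
    by (auto simp: norm_mult)
qed

lemma L2_on_cmult: "L2_on S f \<Longrightarrow> L2_on S (\<lambda>x. c * f x)"
  unfolding L2_on_def by (auto simp: norm_mult power_mult_distrib)

lemma L2_on_diff:
  assumes f: "L2_on S f" and g: "L2_on S g"
  shows "L2_on S (\<lambda>x. f x - g x)"
proof -
  have [measurable]: "f \<in> borel_measurable (lebesgue_on S)" "g \<in> borel_measurable (lebesgue_on S)"
    using f g unfolding L2_on_def by auto
  have "integrable (lebesgue_on S) (\<lambda>x. (cmod (f x - g x))\<^sup>2)"
  proof (rule Bochner_Integration.integrable_bound)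
    show "integrable (lebesgue_on S) (\<lambda>x. 2 * (cmod (f x))\<^sup>2 + 2 * (cmod (g x))\<^sup>2)"
      using f g unfolding L2_on_def by auto
    have "(cmod (u - v))\<^sup>2 \<le> 2 * (cmod u)\<^sup>2 + 2 * (cmod v)\<^sup>2" for u v
    proof -
      have "(cmod (u - v))\<^sup>2 \<le> (cmod u + cmod v)\<^sup>2"
        by (intro power_mono norm_triangle_ineq4) auto
      also have "\<dots> \<le> 2 * (cmod u)\<^sup>2 + 2 * (cmod v)\<^sup>2"
        using sum_squares_bound[of "cmod u" "cmod v"] by (simp add: power2_sum)
      finally show ?thesis .
    qed
    then show "AE x in lebesgue_on S. norm ((cmod (f x - g x))\<^sup>2)
        \<le> norm (2 * (cmod (f x))\<^sup>2 + 2 * (cmod (g x))\<^sup>2)"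
      by auto
  qed measurable
  then show ?thesis unfolding L2_on_def by auto
qed

lemma L2_on_sum:
  assumes "finite J" and "\<And>i. i \<in> J \<Longrightarrow> L2_on S (e i)"
  shows "L2_on S (\<lambda>x. \<Sum>i\<in>J. c i * e i x)"
  using assms
proof (induction J)
  case empty
  then show ?case by (simp add: L2_on_def)
next
  case (insert i J)
  \<comment> \<open>The new term is added by subtracting its negative, since closure under
    differences and scalar multiples is already available.\<close>
  have "L2_on S (\<lambda>x. (\<Sum>i\<in>J. c i * e i x) - (- c i) * e i x)"
    by (intro L2_on_diff L2_on_cmult insert) (use insert in auto)
  then show ?case using insert by (simp add: algebra_simps)
qed

lemma L2_norm_on_power2: "(L2_norm_on S f)\<^sup>2 = (LINT x|lebesgue_on S. (cmod (f x))\<^sup>2)"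
  unfolding L2_norm_on_def by (simp add: integral_nonneg_AE)

lemma L2_norm_on_inner: "of_real ((L2_norm_on S f)\<^sup>2) = L2_inner_on S f f"
  unfolding L2_norm_on_power2 L2_inner_on_def integral_complex_of_real[symmetric]
  by (simp only: complex_norm_square)

lemma L2_inner_on_diff_left:
  assumes "L2_on S f" "L2_on S g" "L2_on S h"
  shows "L2_inner_on S (\<lambda>x. f x - g x) h = L2_inner_on S f h - L2_inner_on S g h"
  unfolding L2_inner_on_def
  using L2_on_mult_integrable[OF assms(1,3)] L2_on_mult_integrable[OF assms(2,3)]
  by (simp add: left_diff_distrib)

lemma L2_inner_on_cnj: "L2_inner_on S f g = cnj (L2_inner_on S g f)"
proof -
  have "cnj (L2_inner_on S g f) = (LINT x|lebesgue_on S. cnj (g x * cnj (f x)))"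
    unfolding L2_inner_on_def by (rule Bochner_Integration.integral_cnj[symmetric])
  then show ?thesis by (simp add: L2_inner_on_def mult.commute)
qed

lemma L2_inner_on_sum_left:
  assumes "finite J" "\<And>i. i \<in> J \<Longrightarrow> L2_on S (e i)" "L2_on S h"
  shows "L2_inner_on S (\<lambda>x. \<Sum>i\<in>J. c i * e i x) h = (\<Sum>i\<in>J. c i * L2_inner_on S (e i) h)"
proof -
  have "L2_inner_on S (\<lambda>x. \<Sum>i\<in>J. c i * e i x) h
      = (LINT x|lebesgue_on S. (\<Sum>i\<in>J. c i * (e i x * cnj (h x))))"
    unfolding L2_inner_on_def by (simp add: sum_distrib_right mult.assoc)
  also have "\<dots> = (\<Sum>i\<in>J. (LINT x|lebesgue_on S. c i * (e i x * cnj (h x))))"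
    by (rule Bochner_Integration.integral_sum)
      (use assms L2_on_mult_integrable in auto)
  finally show ?thesis by (simp add: L2_inner_on_def)
qed

text \<open>Expand the square and complete it in each coefficient. With \<open>c\<close> arbitrary,
  one identity serves twice: Fourier coefficients in place of \<open>c\<close> give Bessel's
  inequality, and any other \<open>c\<close> approximates no better than they do.\<close>

lemma L2_best_approximation:
  assumes J: "finite J" and e: "\<And>i. i \<in> J \<Longrightarrow> L2_on S (e i)"
    and on: "\<And>i j. i \<in> J \<Longrightarrow> j \<in> J \<Longrightarrow> L2_inner_on S (e i) (e j) = (if i = j then 1 else 0)"
    and f: "L2_on S f"
  shows "(L2_norm_on S (\<lambda>x. f x - (\<Sum>i\<in>J. c i * e i x)))\<^sup>2 =
    (L2_norm_on S f)\<^sup>2 - (\<Sum>i\<in>J. (cmod (L2_inner_on S f (e i)))\<^sup>2)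
      + (\<Sum>i\<in>J. (cmod (c i - L2_inner_on S f (e i)))\<^sup>2)"
proof -
  define g where "g = (\<lambda>x. \<Sum>i\<in>J. c i * e i x)"
  define \<gamma> where "\<gamma> i = L2_inner_on S f (e i)" for i
  have g: "L2_on S g" unfolding g_def by (rule L2_on_sum[OF J e])
  have ge: "L2_inner_on S g (e j) = c j" if "j \<in> J" for j
    unfolding g_def using that J e
    by (simp add: L2_inner_on_sum_left on if_distrib sum.delta cong: if_cong)
  have gg: "L2_inner_on S g h = (\<Sum>i\<in>J. c i * cnj (L2_inner_on S h (e i)))" if "L2_on S h" for h
    unfolding g_def using J e that L2_inner_on_cnj[of S "e _" h]
    by (simp add: L2_inner_on_sum_left)
  have fg: "L2_inner_on S f g = (\<Sum>i\<in>J. cnj (c i) * \<gamma> i)"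
    by (subst L2_inner_on_cnj) (simp add: gg[OF f] \<gamma>_def)
  have "of_real ((L2_norm_on S (\<lambda>x. f x - g x))\<^sup>2) = L2_inner_on S (\<lambda>x. f x - g x) (\<lambda>x. f x - g x)"
    by (rule L2_norm_on_inner)
  also have "\<dots> = L2_inner_on S f (\<lambda>x. f x - g x) - L2_inner_on S g (\<lambda>x. f x - g x)"
    by (intro L2_inner_on_diff_left f g L2_on_diff)
  also have "\<dots> = cnj (L2_inner_on S (\<lambda>x. f x - g x) f) - cnj (L2_inner_on S (\<lambda>x. f x - g x) g)"
    by (metis L2_inner_on_cnj)
  also have "\<dots> = cnj (L2_inner_on S f f - L2_inner_on S g f) - cnj (L2_inner_on S f g - L2_inner_on S g g)"
    by (simp add: L2_inner_on_diff_left f g)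
  also have "\<dots> = cnj (L2_inner_on S f f) +
     (\<Sum>i\<in>J. - (cnj (c i) * \<gamma> i) - c i * cnj (\<gamma> i) + c i * cnj (c i))"
    by (simp add: fg gg f g ge \<gamma>_def[symmetric] sum.distrib sum_negf sum_subtractf mult.commute cong: sum.cong)
  also have "\<dots> = of_real ((L2_norm_on S f)\<^sup>2) + (\<Sum>i\<in>J. of_real ((cmod (c i - \<gamma> i))\<^sup>2 - (cmod (\<gamma> i))\<^sup>2))"
    by (simp only: L2_norm_on_inner[symmetric] complex_cnj_complex_of_real of_real_diff complex_norm_square)
      (simp add: algebra_simps)
  also have "\<dots> = of_real ((L2_norm_on S f)\<^sup>2 - (\<Sum>i\<in>J. (cmod (\<gamma> i))\<^sup>2) + (\<Sum>i\<in>J. (cmod (c i - \<gamma> i))\<^sup>2))"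
    by (simp add: sum_subtractf)
  finally show ?thesis unfolding g_def \<gamma>_def of_real_eq_iff .
qed

text \<open>Partial sums of the squared coefficients increase with the finite set and are bounded by
  Bessel's inequality; density provides one finite set whose partial sum is already within
  \<open>\<epsilon>\<close> of the bound.\<close>

lemma L2_parseval:
  assumes onb: "L2_orthonormal_basis S I e" and f: "L2_on S f"
  shows "((\<lambda>i. (cmod (L2_inner_on S f (e i)))\<^sup>2) has_sum (L2_norm_on S f)\<^sup>2) I"
proof -
  have e: "\<And>i. i \<in> I \<Longrightarrow> L2_on S (e i)"
    and on: "\<And>i j. i \<in> I \<Longrightarrow> j \<in> I \<Longrightarrow> L2_inner_on S (e i) (e j) = (if i = j then 1 else 0)"
    and dense: "\<And>\<epsilon>. \<epsilon> > 0 \<Longrightarrow> \<exists>J c. finite J \<and> J \<subseteq> I \<and>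
           L2_norm_on S (\<lambda>x. f x - (\<Sum>i\<in>J. c i * e i x)) < \<epsilon>"
    using onb f unfolding L2_orthonormal_basis_def by auto
  define \<gamma> where "\<gamma> i = (cmod (L2_inner_on S f (e i)))\<^sup>2" for i
  have approx: "(L2_norm_on S (\<lambda>x. f x - (\<Sum>i\<in>J. c i * e i x)))\<^sup>2 =
    (L2_norm_on S f)\<^sup>2 - sum \<gamma> J + (\<Sum>i\<in>J. (cmod (c i - L2_inner_on S f (e i)))\<^sup>2)"
    if "finite J" "J \<subseteq> I" for J c
    unfolding \<gamma>_def by (rule L2_best_approximation) (use that e on f subsetD[OF that(2)] in \<open>auto simp del: subset_iff\<close>)
  have bessel: "sum \<gamma> J \<le> (L2_norm_on S f)\<^sup>2" if "finite J" "J \<subseteq> I" for J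
    using approx[OF that, of "\<lambda>i. L2_inner_on S f (e i)"]
      zero_le_power2[of "L2_norm_on S (\<lambda>x. f x - (\<Sum>i\<in>J. L2_inner_on S f (e i) * e i x))"]
    by simp
  show ?thesis
    unfolding \<gamma>_def[symmetric] has_sum_def tendsto_iff eventually_finite_subsets_at_top
  proof (intro allI impI)
    fix \<epsilon> :: real assume "\<epsilon> > 0"
    then obtain J c where J: "finite J" "J \<subseteq> I"
      and lt: "L2_norm_on S (\<lambda>x. f x - (\<Sum>i\<in>J. c i * e i x)) < sqrt \<epsilon>"
      using dense[of "sqrt \<epsilon>"] by auto
    have "L2_norm_on S (\<lambda>x. f x - (\<Sum>i\<in>J. c i * e i x)) \<ge> 0"
      by (simp add: L2_norm_on_def integral_nonneg_AE)
    then have "(L2_norm_on S (\<lambda>x. f x - (\<Sum>i\<in>J. c i * e i x)))\<^sup>2 < (sqrt \<epsilon>)\<^sup>2"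
      by (intro power_strict_mono[OF lt]) auto
    \<comment> \<open>By the best-approximation identity, the squared error of \<open>c\<close> is
      at least the norm squared minus the partial sum over \<open>J\<close>.\<close>
    then have gt: "(L2_norm_on S f)\<^sup>2 - sum \<gamma> J < \<epsilon>"
      using approx[OF J, of c] sum_nonneg[of J "\<lambda>i. (cmod (c i - L2_inner_on S f (e i)))\<^sup>2"] \<open>\<epsilon> > 0\<close>
      by simp
    show "\<exists>X. finite X \<and> X \<subseteq> I \<and>
      (\<forall>Y. finite Y \<and> X \<subseteq> Y \<and> Y \<subseteq> I \<longrightarrow> dist (sum \<gamma> Y) ((L2_norm_on S f)\<^sup>2) < \<epsilon>)"
    proof (rule exI[of _ J], intro conjI allI impI J)
      fix Y assume Y: "finite Y \<and> J \<subseteq> Y \<and> Y \<subseteq> I"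
      have "sum \<gamma> J \<le> sum \<gamma> Y" using Y by (intro sum_mono2) (auto simp: \<gamma>_def)
      then show "dist (sum \<gamma> Y) ((L2_norm_on S f)\<^sup>2) < \<epsilon>"
        using bessel[of Y] Y gt by (auto simp: dist_real_def)
    qed
  qed
qed

section \<open>Spectral pairs on the line\<close>

text \<open>The character exp(2 pi i s x). Being symmetric in its arguments, it is read both as an
  exponential on \<open>\<Omega>\<close> with frequency \<open>s\<close> and, for a difference
  \<open>s\<close> of points, as a function of the frequency in \<open>\<Lambda>\<close>.\<close>

definition chr :: "real \<Rightarrow> real \<Rightarrow> complex" where
  "chr s x = cis (2 * pi * s * x)"

lemma chr_commute: "chr s x = chr x s"
  by (simp add: chr_def ac_simps)

lemma chr_0 [simp]: "chr 0 x = 1" "chr s 0 = 1"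
  by (simp_all add: chr_def)

lemma norm_chr [simp]: "cmod (chr s x) = 1"
  by (simp add: chr_def)

lemma chr_nonzero [simp]: "chr s x \<noteq> 0"
  using norm_chr[of s x] by (metis norm_zero zero_neq_one)

lemma chr_add: "chr (s + t) x = chr s x * chr t x"
  by (simp add: chr_def cis_mult ring_distribs)

lemma chr_add_right: "chr s (x + y) = chr s x * chr s y"
  by (simp add: chr_def cis_mult ring_distribs)

lemma cnj_chr: "cnj (chr s x) = chr (- s) x"
  by (simp add: chr_def cis_cnj)

lemma chr_mult_cnj [simp]: "chr s x * cnj (chr s x) = 1" "cnj (chr s x) * chr s x = 1"
  by (simp_all add: chr_def cis_cnj cis_mult)

lemma chr_diff: "chr (s - t) x = chr s x * cnj (chr t x)"
  using chr_add[of s "- t" x] by (simp add: cnj_chr)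

lemma chr_diff_right: "chr s (x - y) = chr s x * cnj (chr s y)"
  by (metis chr_diff chr_commute)

lemma exp_eq_chr: "exp (2 * of_real pi * \<i> * of_real s * of_real x) = chr s x"
  by (simp add: chr_def cis_conv_exp mult_ac)

lemma continuous_chr [continuous_intros]: "continuous_on A (chr s)"
  unfolding chr_def by (intro continuous_intros)

lemma chr_measurable [measurable]: "chr s \<in> borel_measurable borel"
  by (intro borel_measurable_continuous_onI continuous_intros)

text \<open>The integral of \<open>chr s\<close> from \<open>x\<close> to \<open>y\<close> in closed
  form, with the removable singularity at \<open>s = 0\<close> filled in.\<close>

definition chr_integral :: "real \<Rightarrow> real \<Rightarrow> real \<Rightarrow> complex" where
  "chr_integral s x y =
     (if s = 0 then of_real (y - x) else (chr s y - chr s x) / (2 * of_real pi * \<i> * of_real s))"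

text \<open>Moving an interval changes its Fourier coefficients only by a phase, so their squared
  moduli depend on the length alone. This lets one weight serve short intervals at all
  positions.\<close>

lemma chr_integral_shift: "chr_integral s (x + d) (y + d) = chr s d * chr_integral s x y"
  by (simp add: chr_integral_def chr_add_right algebra_simps)

lemma chr_has_integral:
  assumes "x \<le> y"
  shows "(chr s has_integral chr_integral s x y) {x..y}"
proof (cases "s = 0")
  case True
  moreover have "chr 0 = (\<lambda>_. 1)"
    by (simp add: fun_eq_iff)
  ultimately show ?thesis using has_integral_const_real[of "1 :: complex" x y] assms
    by (simp add: chr_integral_def scaleR_conv_of_real)
next
  case False
  have "((\<lambda>t. chr s t / (2 * of_real pi * \<i> * of_real s)) has_vector_derivative chr s t)
          (at t within {x..y})" for t
  proof -
    let ?c = "2 * of_real pi * \<i> * of_real s"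
    have "((\<lambda>z. exp (?c * z) / ?c) has_field_derivative exp (?c * of_real t)) (at (of_real t))"
      using False by (auto intro!: derivative_eq_intros)
    from has_vector_derivative_real_field[OF this] show ?thesis
      by (simp add: exp_eq_chr)
  qed
  from fundamental_theorem_of_calculus[OF assms this] show ?thesis
    using False by (simp add: chr_integral_def diff_divide_distrib)
qed

lemma chr_set_integral:
  assumes "x \<le> y"
  shows "(LINT t:{x..<y}|lebesgue. chr s t) = chr_integral s x y"
proof -
  have "set_integrable lebesgue {x..y} (chr s)"
    by (intro absolutely_integrable_continuous_real continuous_intros)
  then have *: "set_integrable lebesgue {x..<y} (chr s)"
    by (rule set_integrable_subset) auto
  have "integral {x..<y} (chr s) = integral {x..y} (chr s)"
  proof (rule integral_subset_negligible)
    show "negligible ({x..y} - {x..<y})"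
      by (rule negligible_subset[of "{y}"]) auto
  qed auto
  then show "(LINT t:{x..<y}|lebesgue. chr s t) = chr_integral s x y"
    using set_lebesgue_integral_eq_integral(2)[OF *] integral_unique[OF chr_has_integral[OF assms]]
    by simp
qed

section \<open>Parseval's identity for indicator functions of intervals\<close>

locale spectral_pair =
  fixes \<Omega> \<Lambda> :: "real set" and L :: real
  assumes lmeas: "\<Omega> \<in> lmeasurable"
    and L_def: "L = measure lebesgue \<Omega>" and L_pos: "L > 0"
    and onb: "L2_orthonormal_basis \<Omega> \<Lambda> (\<lambda>\<xi> x. of_real (L powr (-1/2)) * chr \<xi> x)"
begin

lemma sets_\<Omega> [measurable, simp]: "\<Omega> \<in> sets lebesgue"
  using lmeas by (rule fmeasurableD)

lemma powr_half_squared: "(L powr - (1 / 2))\<^sup>2 = 1 / L"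
  using L_pos powr_add[of L "-1/2" "-1/2"] by (simp add: power2_eq_square powr_minus_divide)

lemma L2_on_bounded:
  assumes "f \<in> borel_measurable lebesgue" and "\<And>x. cmod (f x) \<le> C"
  shows "L2_on \<Omega> f"
  unfolding L2_on_def
proof
  show [measurable]: "f \<in> borel_measurable (lebesgue_on \<Omega>)"
    using assms(1) by (rule measurable_restrict_space1)
  show "integrable (lebesgue_on \<Omega>) (\<lambda>x. (cmod (f x))\<^sup>2)"
  proof (rule Bochner_Integration.integrable_bound)
    show "integrable (lebesgue_on \<Omega>) (\<lambda>x. C\<^sup>2)"
      using lmeas by (intro finite_measure.integrable_const finite_measure_lebesgue_on)
    show "AE x in lebesgue_on \<Omega>. norm ((cmod (f x))\<^sup>2) \<le> norm (C\<^sup>2)"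
      using power_mono[OF assms(2) norm_ge_zero, where n = 2] by simp
  qed measurable
qed

lemma L2_on_interval_chr: "L2_on \<Omega> (\<lambda>t. indicator {x..<y} t * chr \<mu> t)"
proof (rule L2_on_bounded[where C = 1])
  have [measurable]: "chr \<mu> \<in> borel_measurable lebesgue" "{x..<y} \<in> sets lebesgue"
    by (auto intro: measurable_completion)
  show "(\<lambda>t. indicator {x..<y} t * chr \<mu> t) \<in> borel_measurable lebesgue"
    by measurable
qed (simp add: norm_mult indicator_def)

lemma L2_on_chr: "L2_on \<Omega> (\<lambda>t. of_real c * chr \<xi> t)"
proof (rule L2_on_bounded[where C = "\<bar>c\<bar>"])
  have [measurable]: "chr \<xi> \<in> borel_measurable lebesgue"
    by (auto intro: measurable_completion)
  show "(\<lambda>t. of_real c * chr \<xi> t) \<in> borel_measurable lebesgue"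
    by measurable
qed (simp add: norm_mult)

lemma L2_inner_interval:
  assumes "x \<le> y" "{x..<y} \<subseteq> \<Omega>"
  shows "L2_inner_on \<Omega> (\<lambda>t. indicator {x..<y} t * chr \<mu> t) (\<lambda>t. of_real (L powr (-1/2)) * chr \<xi> t)
    = of_real (L powr (-1/2)) * chr_integral (\<mu> - \<xi>) x y"
proof -
  have "L2_inner_on \<Omega> (\<lambda>t. indicator {x..<y} t * chr \<mu> t) (\<lambda>t. of_real (L powr (-1/2)) * chr \<xi> t)
     = (LINT t|lebesgue. indicator \<Omega> t *\<^sub>R
           (indicator {x..<y} t * chr \<mu> t * cnj (of_real (L powr (-1/2)) * chr \<xi> t)))"
    unfolding L2_inner_on_def by (rule integral_restrict_space) simp
  also have "\<dots> = (LINT t|lebesgue. of_real (L powr (-1/2)) * (indicator {x..<y} t *\<^sub>R chr (\<mu> - \<xi>) t))"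
    by (rule Bochner_Integration.integral_cong)
      (use assms in \<open>auto simp: indicator_def chr_diff\<close>)
  also have "\<dots> = of_real (L powr (-1/2)) * chr_integral (\<mu> - \<xi>) x y"
    unfolding chr_set_integral[OF assms(1), symmetric] set_lebesgue_integral_def
    by (rule integral_mult_right_zero)
  finally show ?thesis .
qed

lemma L2_norm_indicator:
  assumes "A \<in> sets lebesgue" "A \<subseteq> \<Omega>" and "\<And>x. cmod (f x) = indicator A x"
  shows "(L2_norm_on \<Omega> f)\<^sup>2 = measure lebesgue A"
proof -
  have "(L2_norm_on \<Omega> f)\<^sup>2 = (LINT x|lebesgue. indicator \<Omega> x *\<^sub>R (cmod (f x))\<^sup>2)"
    unfolding L2_norm_on_power2 by (rule integral_restrict_space) simp
  also have "\<dots> = (LINT x|lebesgue. indicator A x)"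
    by (rule Bochner_Integration.integral_cong) (use assms in \<open>auto simp: indicator_def\<close>)
  finally show ?thesis using assms by simp
qed

text \<open>Parseval for the interval's indicator modulated by \<open>chr \<mu>\<close>; the divisor
  \<open>L\<close> comes from normalizing the exponentials. Taking \<open>\<mu> = 0\<close> yields
  the annihilating weights, and \<open>\<mu>\<close> in the spectrum serves to test a single
  interval against \<open>\<Omega>\<close>.\<close>

lemma parseval_interval:
  assumes "x \<le> y" "{x..<y} \<subseteq> \<Omega>"
  shows "((\<lambda>\<xi>. (cmod (chr_integral (\<mu> - \<xi>) x y))\<^sup>2 / L) has_sum (y - x)) \<Lambda>"
proof -
  let ?f = "\<lambda>t. indicator {x..<y} t * chr \<mu> t"
  have "(L2_norm_on \<Omega> ?f)\<^sup>2 = measure lebesgue {x..<y}"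
    by (rule L2_norm_indicator) (use assms in \<open>auto simp: norm_mult indicator_def\<close>)
  with L2_parseval[OF onb L2_on_interval_chr, of x y \<mu>] show ?thesis
    unfolding L2_inner_interval[OF assms] using assms(1)
    by (simp add: norm_mult power_mult_distrib powr_half_squared mult.commute)
qed

text \<open>Two disjoint translates of a short interval are orthogonal; by polarization this is a
  vanishing condition on the squared Fourier coefficients of the interval.\<close>

lemma parseval_two_intervals:
  assumes "\<epsilon> > 0" "\<epsilon> \<le> \<bar>x - y\<bar>" "{x..<x+\<epsilon>} \<subseteq> \<Omega>" "{y..<y+\<epsilon>} \<subseteq> \<Omega>"
  shows "((\<lambda>\<xi>. of_real ((cmod (chr_integral (- \<xi>) 0 \<epsilon>))\<^sup>2 / L) * chr (x - y) \<xi>) has_sum 0) \<Lambda>"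
proof -
  define \<omega> where "\<omega> \<xi> = (cmod (chr_integral (- \<xi>) 0 \<epsilon>))\<^sup>2 / L" for \<xi>
  have shift: "chr_integral (- \<xi>) z (z + \<epsilon>) = chr (- \<xi>) z * chr_integral (- \<xi>) 0 \<epsilon>" for \<xi> z
    using chr_integral_shift[of "- \<xi>" 0 z \<epsilon>] by (simp add: add.commute)
  have \<omega>: "(\<omega> has_sum \<epsilon>) \<Lambda>"
    using parseval_interval[of x "x + \<epsilon>" 0] assms
    by (simp add: shift norm_mult \<omega>_def[abs_def])
  \<comment> \<open>Parseval for the first indicator plus \<open>c\<close> times the second has
    total \<open>2 * \<epsilon>\<close>. Subtracting twice the sum for a single interval leaves only
    the cross term.\<close>
  have *: "((\<lambda>\<xi>. \<omega> \<xi> * Re (cnj c * chr (- \<xi>) (x - y))) has_sum 0) \<Lambda>" if c: "cmod c = 1" for c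
  proof -
    let ?g = "\<lambda>z t. indicator {z..<z+\<epsilon>} t * chr 0 t :: complex"
    let ?f = "\<lambda>t. ?g x t - (- c) * ?g y t"
    note L2g = L2_on_interval_chr[of _ _ 0] and L2e = L2_on_chr
    have "L2_inner_on \<Omega> ?f (\<lambda>t. of_real (L powr (-1/2)) * chr \<xi> t)
       = of_real (L powr (-1/2)) * chr_integral (- \<xi>) 0 \<epsilon> * (chr (- \<xi>) x + c * chr (- \<xi>) y)" for \<xi>
    proof -
      have "L2_inner_on \<Omega> (\<lambda>t. (- c) * ?g y t) (\<lambda>t. of_real (L powr (-1/2)) * chr \<xi> t)
         = (- c) * L2_inner_on \<Omega> (?g y) (\<lambda>t. of_real (L powr (-1/2)) * chr \<xi> t)"
        using L2_inner_on_sum_left[of "{0::nat}" \<Omega> "\<lambda>_. ?g y" _ "\<lambda>_. - c", OF _ L2g L2e] by (simp add: mult.assoc)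
      then show ?thesis
        unfolding L2_inner_on_diff_left[OF L2g L2_on_cmult[OF L2g] L2e]
        using L2_inner_interval[of x "x + \<epsilon>" 0 \<xi>] L2_inner_interval[of y "y + \<epsilon>" 0 \<xi>] assms
        by (simp add: shift shift[unfolded add.commute[of _ \<epsilon>]] algebra_simps)
    qed
    moreover have polarize: "(cmod (u + c * v))\<^sup>2 = 2 + 2 * Re (cnj c * (u * cnj v))"
      if "cmod u = 1" "cmod v = 1" for u v
    proof -
      define w where "w = c * v"
      have "cmod w = 1" using that c by (simp add: w_def norm_mult)
      then have "(Re u)\<^sup>2 + (Im u)\<^sup>2 = 1" "(Re w)\<^sup>2 + (Im w)\<^sup>2 = 1"
        using that by (metis cmod_power2 one_power2)+
      then have "(cmod (u + w))\<^sup>2 = 2 + 2 * Re (u * cnj w)"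
        by (simp add: cmod_power2 power2_sum algebra_simps)
      then show ?thesis by (simp add: w_def mult_ac)
    qed
    have "(cmod (chr (- \<xi>) x + c * chr (- \<xi>) y))\<^sup>2 = 2 + 2 * Re (cnj c * chr (- \<xi>) (x - y))" for \<xi>
      unfolding chr_diff_right by (rule polarize) simp_all
    ultimately have coeff: "(cmod (L2_inner_on \<Omega> ?f (\<lambda>t. of_real (L powr (-1/2)) * chr \<xi> t)))\<^sup>2
       = \<omega> \<xi> * (2 + 2 * Re (cnj c * chr (- \<xi>) (x - y)))" for \<xi>
      by (simp add: norm_mult power_mult_distrib powr_half_squared \<omega>_def)
    have "(L2_norm_on \<Omega> ?f)\<^sup>2 = measure lebesgue ({x..<x+\<epsilon>} \<union> {y..<y+\<epsilon>})"
      by (rule L2_norm_indicator) (use assms c in \<open>auto simp: indicator_def\<close>)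
    also have "\<dots> = 2 * \<epsilon>"
    proof (subst measure_Un2)
      show "{x..<x+\<epsilon>} \<in> lmeasurable" "{y..<y+\<epsilon>} \<in> lmeasurable"
        by (auto intro!: bounded_set_imp_lmeasurable intro: bounded_subset[OF bounded_closed_interval])
      have "{y..<y+\<epsilon>} - {x..<x+\<epsilon>} = {y..<y+\<epsilon>}" using assms by auto
      then show "measure lebesgue {x..<x+\<epsilon>} + measure lebesgue ({y..<y+\<epsilon>} - {x..<x+\<epsilon>}) = 2 * \<epsilon>"
        using assms(1) by simp
    qed
    finally have norm_f: "(L2_norm_on \<Omega> ?f)\<^sup>2 = 2 * \<epsilon>" .
    have "L2_on \<Omega> ?f" by (rule L2_on_diff[OF L2g L2_on_cmult[OF L2g]])
    from L2_parseval[OF onb this]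
    have "((\<lambda>\<xi>. \<omega> \<xi> * (2 + 2 * Re (cnj c * chr (- \<xi>) (x - y)))) has_sum 2 * \<epsilon>) \<Lambda>"
      unfolding coeff norm_f .
    from has_sum_add[OF this has_sum_cmult_right[OF \<omega>, of "- 2"]]
    have "((\<lambda>\<xi>. \<omega> \<xi> * (2 + 2 * Re (cnj c * chr (- \<xi>) (x - y))) + - 2 * \<omega> \<xi>) has_sum 0) \<Lambda>"
      by simp
    moreover have "\<omega> \<xi> * (2 + 2 * r) + - 2 * \<omega> \<xi> = 2 * (\<omega> \<xi> * r)" for \<xi> r
      by (simp add: algebra_simps)
    ultimately have "((\<lambda>\<xi>. 2 * (\<omega> \<xi> * Re (cnj c * chr (- \<xi>) (x - y)))) has_sum 0) \<Lambda>"
      by (simp only:)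
    from has_sum_cmult_right[OF this, of "1/2"] show ?thesis by simp
  qed
  \<comment> \<open>The choices \<open>c = 1\<close> and \<open>c = - \<i>\<close> give the real and
    the imaginary part of the character.\<close>
  have "((\<lambda>\<xi>. \<omega> \<xi> * Re (chr (x - y) \<xi>)) has_sum 0) \<Lambda>"
    using *[of 1] by (simp add: chr_def mult_ac)
  moreover have "((\<lambda>\<xi>. \<omega> \<xi> * Im (chr (x - y) \<xi>)) has_sum 0) \<Lambda>"
    using *[of "- \<i>"] by (simp add: chr_def mult_ac)
  ultimately have "((\<lambda>\<xi>. of_real (\<omega> \<xi> * Re (chr (x - y) \<xi>)) + \<i> * of_real (\<omega> \<xi> * Im (chr (x - y) \<xi>)))
      has_sum of_real 0 + \<i> * of_real 0) \<Lambda>"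
    by (intro has_sum_add has_sum_cmult_right has_sum_of_real)
  moreover have "of_real (\<omega> \<xi> * Re (chr (x - y) \<xi>)) + \<i> * of_real (\<omega> \<xi> * Im (chr (x - y) \<xi>))
      = of_real (\<omega> \<xi>) * chr (x - y) \<xi>" for \<xi>
    by (simp add: complex_eq_iff)
  ultimately show ?thesis
    unfolding \<omega>_def[symmetric] by simp
qed

end

section \<open>Annihilating weights and the boundary matrix\<close>

text \<open>The expectation over the spectrum with weights \<open>\<omega>\<close>. An infinite sum
  that does not converge has value 0, so the additivity lemmas ask for bounded functions, which are
  summable against weights of total 1.\<close>

definition mean :: "real set \<Rightarrow> (real \<Rightarrow> real) \<Rightarrow> (real \<Rightarrow> complex) \<Rightarrow> complex" where
  "mean \<Lambda> \<omega> f = (\<Sum>\<^sub>\<infinity>\<xi>\<in>\<Lambda>. of_real (\<omega> \<xi>) * f \<xi>)"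

locale weights =
  fixes \<Lambda> :: "real set" and \<omega> :: "real \<Rightarrow> real"
  assumes nonneg: "\<omega> \<xi> \<ge> 0" and total: "(\<omega> has_sum 1) \<Lambda>"
begin

lemma summable_bounded:
  assumes "\<And>\<xi>. \<xi> \<in> \<Lambda> \<Longrightarrow> cmod (f \<xi>) \<le> C"
  shows "(\<lambda>\<xi>. of_real (\<omega> \<xi>) * f \<xi>) summable_on \<Lambda>"
proof (rule abs_summable_summable, rule Infinite_Sum.abs_summable_on_comparison_test)
  show "(\<lambda>\<xi>. norm (C * \<omega> \<xi>)) summable_on \<Lambda>"
    using has_sum_imp_summable[OF has_sum_cmult_right[OF total, of "\<bar>C\<bar>"]] nonneg
    by (simp add: abs_mult)
  show "norm (of_real (\<omega> \<xi>) * f \<xi>) \<le> norm (C * \<omega> \<xi>)" if "\<xi> \<in> \<Lambda>" for \<xi>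
  proof -
    have "cmod (f \<xi>) * \<omega> \<xi> \<le> C * \<omega> \<xi>"
      by (rule mult_right_mono[OF assms[OF that] nonneg])
    also have "\<dots> \<le> \<bar>C * \<omega> \<xi>\<bar>" by simp
    finally show ?thesis using nonneg[of \<xi>] by (simp add: norm_mult mult.commute)
  qed
qed

lemma mean_const: "mean \<Lambda> \<omega> (\<lambda>_. c) = c"
proof -
  have "(\<Sum>\<^sub>\<infinity>\<xi>\<in>\<Lambda>. complex_of_real (\<omega> \<xi>)) = 1"
    using infsumI[OF has_sum_of_real[OF total]] by simp
  then show ?thesis by (simp add: mean_def infsum_cmult_left')
qed

lemma mean_cmult: "mean \<Lambda> \<omega> (\<lambda>\<xi>. c * f \<xi>) = c * mean \<Lambda> \<omega> f"
  unfolding mean_def by (simp add: mult.left_commute infsum_cmult_right')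

lemma mean_cong: "(\<And>\<xi>. \<xi> \<in> \<Lambda> \<Longrightarrow> f \<xi> = g \<xi>) \<Longrightarrow> mean \<Lambda> \<omega> f = mean \<Lambda> \<omega> g"
  unfolding mean_def by (rule infsum_cong) simp

lemma mean_add:
  assumes "\<And>\<xi>. \<xi> \<in> \<Lambda> \<Longrightarrow> cmod (f \<xi>) \<le> C" "\<And>\<xi>. \<xi> \<in> \<Lambda> \<Longrightarrow> cmod (g \<xi>) \<le> D"
  shows "mean \<Lambda> \<omega> (\<lambda>\<xi>. f \<xi> + g \<xi>) = mean \<Lambda> \<omega> f + mean \<Lambda> \<omega> g"
  unfolding mean_def
  using infsum_add[OF summable_bounded[OF assms(1)] summable_bounded[OF assms(2)]]
  by (simp only: ring_distribs)

lemma mean_sum: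
  assumes "finite K" "\<And>k \<xi>. k \<in> K \<Longrightarrow> \<xi> \<in> \<Lambda> \<Longrightarrow> cmod (f k \<xi>) \<le> C"
  shows "mean \<Lambda> \<omega> (\<lambda>\<xi>. \<Sum>k\<in>K. c k * f k \<xi>) = (\<Sum>k\<in>K. c k * mean \<Lambda> \<omega> (f k))"
  using assms
proof (induction K)
  case empty
  then show ?case by (simp add: mean_def)
next
  case (insert k K)
  have "mean \<Lambda> \<omega> (\<lambda>\<xi>. c k * f k \<xi> + (\<Sum>k\<in>K. c k * f k \<xi>))
     = mean \<Lambda> \<omega> (\<lambda>\<xi>. c k * f k \<xi>) + mean \<Lambda> \<omega> (\<lambda>\<xi>. \<Sum>k\<in>K. c k * f k \<xi>)"
  proof (rule mean_add)
    show "cmod (c k * f k \<xi>) \<le> cmod (c k) * C" if "\<xi> \<in> \<Lambda>" for \<xi>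
      using insert.prems(1)[of k \<xi>] that by (simp add: norm_mult mult_left_mono)
    show "cmod (\<Sum>k\<in>K. c k * f k \<xi>) \<le> (\<Sum>k\<in>K. cmod (c k) * C)" if "\<xi> \<in> \<Lambda>" for \<xi>
      using insert.prems(1) that by (intro sum_norm_le) (auto simp: norm_mult intro!: mult_left_mono)
  qed
  then show ?case using insert.hyps insert.IH insert.prems mean_cmult[of "c k" "f k"] by simp
qed

lemma mean_chr_minus: "mean \<Lambda> \<omega> (chr (- s)) = cnj (mean \<Lambda> \<omega> (chr s))"
  unfolding mean_def infsum_cnj[symmetric] by (simp add: cnj_chr)

end

section \<open>Finite unions of half-open intervals with a spectrum\<close>

locale interval_spectrum = spectral_pair +
  fixes K :: "nat set" and a b :: "nat \<Rightarrow> real"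
  assumes fin: "finite K"
    and less: "j \<in> K \<Longrightarrow> a j < b j"
    and disj: "disjoint_family_on (\<lambda>j. {a j..<b j}) K"
    and \<Omega>_eq: "\<Omega> = (\<Union>j\<in>K. {a j..<b j})"
begin

text \<open>These are the exponents that some mean over the spectrum annihilates; through them the
  position of the intervals enters the algebra.\<close>

definition differences :: "real set" where
  "differences = {s. s \<noteq> 0 \<and> (\<exists>x\<in>\<Omega>. \<exists>y\<in>\<Omega>. s = x - y)}"

text \<open>A half-open interval leaves room to the right of each of its points, its left end point
  included.\<close>

lemma room:
  assumes "x \<in> \<Omega>"
  shows "eventually (\<lambda>\<epsilon>. {x..<x + \<epsilon>} \<subseteq> \<Omega>) (at_right 0)"
proof -
  from assms obtain j where "j \<in> K" "a j \<le> x" "x < b j" unfolding \<Omega>_eq by auto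
  have "{x..<x + \<epsilon>} \<subseteq> \<Omega>" if "\<epsilon> < b j - x" for \<epsilon>
  proof -
    have "{x..<x + \<epsilon>} \<subseteq> {a j..<b j}" using \<open>a j \<le> x\<close> that by auto
    then show ?thesis using \<open>j \<in> K\<close> unfolding \<Omega>_eq by blast
  qed
  then show ?thesis unfolding eventually_at_right_field
    using \<open>x < b j\<close> by (intro exI[of _ "b j - x"]) simp
qed

lemma \<Omega>_nonempty: "\<Omega> \<noteq> {}"
proof
  assume "\<Omega> = {}"
  then show False using L_pos unfolding L_def by simp
qed

text \<open>Take the squared Fourier coefficients of an interval so short that, for every
  \<open>s\<close> in \<open>S\<close>, two disjoint translates of it at distance
  \<open>\<bar>s\<bar>\<close> fit into \<open>\<Omega>\<close>. The weights do not depend on where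
  the translates lie, so one choice works for all of \<open>S\<close>.\<close>

lemma ex_annihilating_weights:
  assumes "finite S" "S \<subseteq> differences"
  shows "\<exists>\<omega>. weights \<Lambda> \<omega> \<and> (\<forall>s\<in>S. mean \<Lambda> \<omega> (chr s) = 0)"
proof -
  let ?P = "\<lambda>s \<epsilon>. \<exists>x y. s = x - y \<and> \<epsilon> \<le> \<bar>s\<bar> \<and> {x..<x + \<epsilon>} \<subseteq> \<Omega> \<and> {y..<y + \<epsilon>} \<subseteq> \<Omega>"
  have "eventually (?P s) (at_right 0)" if "s \<in> S" for s
  proof -
    from that assms obtain x y where xy: "x \<in> \<Omega>" "y \<in> \<Omega>" "s = x - y" "s \<noteq> 0"
      unfolding differences_def by blast
    have "eventually (\<lambda>\<epsilon>. \<epsilon> \<le> \<bar>s\<bar>) (at_right 0)"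
      unfolding eventually_at_right_field using xy by (intro exI[of _ "\<bar>s\<bar>"]) auto
    with room[OF xy(1)] room[OF xy(2)] show ?thesis
      by eventually_elim (use xy in blast)
  qed
  then have "eventually (\<lambda>\<epsilon>. \<forall>s\<in>S. ?P s \<epsilon>) (at_right 0)"
    by (intro eventually_ball_finite assms) auto
  moreover obtain z where "z \<in> \<Omega>" using \<Omega>_nonempty by auto
  ultimately have "eventually (\<lambda>\<epsilon>. 0 < \<epsilon> \<and> {z..<z + \<epsilon>} \<subseteq> \<Omega> \<and> (\<forall>s\<in>S. ?P s \<epsilon>)) (at_right (0::real))"
    by (intro eventually_conj eventually_at_right_less room)
  then obtain \<epsilon> :: real where \<epsilon>: "0 < \<epsilon>" "{z..<z + \<epsilon>} \<subseteq> \<Omega>" and S: "\<And>s. s \<in> S \<Longrightarrow> ?P s \<epsilon>"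
    using eventually_happens'[OF trivial_limit_at_right_real] by blast
  \<comment> \<open>The sum of the squared coefficients divided by \<open>L\<close> is the length
    \<open>\<epsilon>\<close>; a further division by \<open>\<epsilon>\<close> makes the total
    1.\<close>
  define \<omega> where "\<omega> \<xi> = (cmod (chr_integral (- \<xi>) 0 \<epsilon>))\<^sup>2 / L / \<epsilon>" for \<xi>
  show ?thesis
  proof (intro exI[of _ \<omega>] conjI ballI)
    have "chr_integral (- \<xi>) z (z + \<epsilon>) = chr (- \<xi>) z * chr_integral (- \<xi>) 0 \<epsilon>" for \<xi>
      using chr_integral_shift[of "- \<xi>" 0 z \<epsilon>] by (simp add: add.commute)
    then have "((\<lambda>\<xi>. (cmod (chr_integral (- \<xi>) 0 \<epsilon>))\<^sup>2 / L) has_sum \<epsilon>) \<Lambda>"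
      using parseval_interval[of z "z + \<epsilon>" 0] \<epsilon> by (simp add: norm_mult)
    from has_sum_cmult_left[OF this, of "1 / \<epsilon>"]
    have "(\<omega> has_sum 1) \<Lambda>"
      using \<epsilon> by (simp add: \<omega>_def[abs_def])
    then show "weights \<Lambda> \<omega>"
      by unfold_locales (use L_pos \<epsilon> in \<open>auto simp: \<omega>_def\<close>)
    fix s assume "s \<in> S"
    then obtain x y where xy: "s = x - y" "\<epsilon> \<le> \<bar>s\<bar>" "{x..<x + \<epsilon>} \<subseteq> \<Omega>" "{y..<y + \<epsilon>} \<subseteq> \<Omega>"
      using S by blast
    from has_sum_cmult_left[OF parseval_two_intervals[of \<epsilon> x y], of "of_real (1 / \<epsilon>)"] xy \<epsilon>
    have "((\<lambda>\<xi>. of_real (\<omega> \<xi>) * chr s \<xi>) has_sum 0) \<Lambda>"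
      by (simp add: \<omega>_def[abs_def] mult_ac)
    then show "mean \<Lambda> \<omega> (chr s) = 0"
      unfolding mean_def by (rule infsumI)
  qed
qed

text \<open>For distinct frequencies the inner product of the exponentials is a nonzero multiple of
  the sum of the boundary terms of \<open>chr (\<xi> - \<mu>)\<close>. For equal frequencies both
  sides count the intervals.\<close>

lemma orthogonality:
  assumes "\<xi> \<in> \<Lambda>" "\<mu> \<in> \<Lambda>"
  shows "(\<Sum>j\<in>K. chr (b j) \<xi> * cnj (chr (b j) \<mu>)) = (\<Sum>j\<in>K. chr (a j) \<xi> * cnj (chr (a j) \<mu>))"
proof (cases "\<xi> = \<mu>")
  case False
  let ?e = "\<lambda>\<xi> t. of_real (L powr (-1/2)) * chr \<xi> t"
  let ?f = "\<lambda>j t. indicator {a j..<b j} t * chr \<xi> t"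
  have "0 = L2_inner_on \<Omega> (?e \<xi>) (?e \<mu>)"
    using onb assms False unfolding L2_orthonormal_basis_def by auto
  \<comment> \<open>On \<open>\<Omega>\<close> exactly one of the indicators is 1, so the
    exponential splits into pieces supported on single intervals.\<close>
  also have "\<dots> = L2_inner_on \<Omega> (\<lambda>t. \<Sum>j\<in>K. of_real (L powr (-1/2)) * ?f j t) (?e \<mu>)"
    unfolding L2_inner_on_def
  proof (rule Bochner_Integration.integral_cong)
    fix t assume "t \<in> space (lebesgue_on \<Omega>)"
    then obtain i where i: "i \<in> K" "t \<in> {a i..<b i}" by (auto simp: \<Omega>_eq)
    have "indicator {a j..<b j} t = (if j = i then 1 else 0 :: complex)" if "j \<in> K" for j
      using disjoint_family_onD[OF disj, of i j] i that by (auto simp: indicator_def)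
    then have "(\<Sum>j\<in>K. of_real (L powr (-1/2)) * ?f j t) = (\<Sum>j\<in>K. if j = i then ?e \<xi> t else 0)"
      by (intro sum.cong) auto
    then show "?e \<xi> t * cnj (?e \<mu> t) = (\<Sum>j\<in>K. of_real (L powr (-1/2)) * ?f j t) * cnj (?e \<mu> t)"
      using i fin by simp
  qed simp
  also have "\<dots> = (\<Sum>j\<in>K. of_real (L powr (-1/2)) * L2_inner_on \<Omega> (?f j) (?e \<mu>))"
    by (rule L2_inner_on_sum_left[OF fin L2_on_interval_chr L2_on_chr])
  also have "\<dots> = (\<Sum>j\<in>K. of_real (L powr (-1/2)) * (of_real (L powr (-1/2)) * chr_integral (\<xi> - \<mu>) (a j) (b j)))"
  proof (rule sum.cong)
    fix j assume "j \<in> K"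
    then show "of_real (L powr (-1/2)) * L2_inner_on \<Omega> (?f j) (?e \<mu>)
      = of_real (L powr (-1/2)) * (of_real (L powr (-1/2)) * chr_integral (\<xi> - \<mu>) (a j) (b j))"
      using less by (subst L2_inner_interval) (force simp: \<Omega>_eq)+
  qed simp
  also have "\<dots> = of_real (L powr (-1/2)) * of_real (L powr (-1/2)) / (2 * of_real pi * \<i> * of_real (\<xi> - \<mu>)) *
      (\<Sum>j\<in>K. chr (\<xi> - \<mu>) (b j) - chr (\<xi> - \<mu>) (a j))"
    using False by (simp add: chr_integral_def sum_distrib_left mult.assoc)
  finally have "(\<Sum>j\<in>K. chr (\<xi> - \<mu>) (b j) - chr (\<xi> - \<mu>) (a j)) = 0"
    using False L_pos by auto
  moreover have "chr (\<xi> - \<mu>) s = chr s \<xi> * cnj (chr s \<mu>)" for s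
    by (metis chr_diff chr_commute)
  ultimately show ?thesis by (simp add: sum_subtractf)
qed simp

text \<open>The boundary matrix of the self-adjoint extension of the momentum operator whose
  eigenfunctions are the exponentials with frequencies in \<open>\<Lambda>\<close>.\<close>

definition boundary_matrix :: "(nat \<Rightarrow> nat \<Rightarrow> complex) \<Rightarrow> bool" where
  "boundary_matrix B \<longleftrightarrow>
     (\<forall>\<xi>\<in>\<Lambda>. \<forall>j\<in>K. chr (b j) \<xi> = (\<Sum>k\<in>K. B j k * chr (a k) \<xi>)) \<and>
     (\<forall>i\<in>K. \<forall>j\<in>K. (\<Sum>k\<in>K. B i k * cnj (B j k)) = (if i = j then 1 else 0)) \<and>
     (\<forall>i\<in>K. \<forall>j\<in>K. (\<Sum>k\<in>K. B k i * cnj (B k j)) = (if i = j then 1 else 0))"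

lemma differencesI:
  assumes "x \<in> {a j..<b j}" "y \<in> {a k..<b k}" "j \<in> K" "k \<in> K" "x \<noteq> y"
  shows "x - y \<in> differences"
proof -
  have "x \<in> \<Omega>" "y \<in> \<Omega>" using assms unfolding \<Omega>_eq by blast+
  then show ?thesis using assms(5) unfolding differences_def by auto
qed

lemma differencesI_disjoint:
  assumes "x \<in> {a j..<b j}" "y \<in> {a k..<b k}" "j \<in> K" "k \<in> K" "j \<noteq> k"
  shows "x - y \<in> differences"
proof (rule differencesI[OF assms(1-4)])
  show "x \<noteq> y" using disjoint_family_onD[OF disj assms(3-5)] assms(1,2) by blast
qed

lemma a_diff: "j \<in> K \<Longrightarrow> k \<in> K \<Longrightarrow> j \<noteq> k \<Longrightarrow> a j - a k \<in> differences"
  by (rule differencesI_disjoint) (use less in auto)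

text \<open>A right end point lies outside its own half-open interval. Moving both end points left
  by the shorter length keeps their difference and puts both into \<open>\<Omega>\<close>.\<close>

lemma b_diff:
  assumes "j \<in> K" "k \<in> K" "j \<noteq> k"
  shows "b j - b k \<in> differences"
proof -
  define \<delta> where "\<delta> = min (b j - a j) (b k - a k)"
  have "(b j - \<delta>) - (b k - \<delta>) \<in> differences"
    by (rule differencesI_disjoint[OF _ _ assms]) (use less[of j] less[of k] assms in \<open>auto simp: \<delta>_def\<close>)
  then show ?thesis by simp
qed

lemma mean_chr_diff: "mean \<Lambda> \<omega> (\<lambda>\<mu>. chr s \<mu> * cnj (chr t \<mu>)) = mean \<Lambda> \<omega> (chr (s - t))"
  by (rule arg_cong[where f = "mean \<Lambda> \<omega>"]) (simp add: fun_eq_iff chr_diff)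

text \<open>Choose a mean that kills all differences of left end points and all differences of right
  end points. Then the left end values form an orthonormal system for this mean, and so do the right
  end values; \<open>B\<close> is the matrix of their mutual inner products. Equality of the two
  Gram kernels shows that \<open>B\<close> maps left to right values, and its conjugate transpose
  maps them back, which gives orthonormal rows and columns.\<close>

lemma ex_boundary_matrix: "\<exists>B. boundary_matrix B"
proof -
  define S where "S = (\<lambda>(j, k). a j - a k) ` {(j, k). j \<in> K \<and> k \<in> K \<and> j \<noteq> k}
     \<union> (\<lambda>(j, k). b j - b k) ` {(j, k). j \<in> K \<and> k \<in> K \<and> j \<noteq> k}"
  have "finite {(j, k). j \<in> K \<and> k \<in> K \<and> j \<noteq> k}"
    by (rule finite_subset[OF _ finite_cartesian_product[OF fin fin]]) auto
  then have fin_S: "finite S" unfolding S_def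
    by simp
  have S_diff: "S \<subseteq> differences" unfolding S_def using a_diff b_diff by auto
  obtain \<omega> where "weights \<Lambda> \<omega>" and \<omega>: "\<And>s. s \<in> S \<Longrightarrow> mean \<Lambda> \<omega> (chr s) = 0"
    using ex_annihilating_weights[OF fin_S S_diff] by blast
  interpret weights \<Lambda> \<omega> by fact
  let ?E = "mean \<Lambda> \<omega>"
  have Ea: "?E (\<lambda>\<mu>. chr (a j) \<mu> * cnj (chr (a k) \<mu>)) = (if j = k then 1 else 0)" if "j \<in> K" "k \<in> K" for j k
  proof (cases "j = k")
    case False
    then have "a j - a k \<in> S" using that unfolding S_def by (intro UnI1 image_eqI[of _ _ "(j, k)"]) auto
    then show ?thesis using False by (simp add: \<omega> mean_chr_diff)
  qed (simp add: mean_const)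
  have Eb: "?E (\<lambda>\<mu>. chr (b j) \<mu> * cnj (chr (b k) \<mu>)) = (if j = k then 1 else 0)" if "j \<in> K" "k \<in> K" for j k
  proof (cases "j = k")
    case False
    then have "b j - b k \<in> S" using that unfolding S_def by (intro UnI2 image_eqI[of _ _ "(j, k)"]) auto
    then show ?thesis using False by (simp add: \<omega> mean_chr_diff)
  qed (simp add: mean_const)
  define B where "B j k = ?E (\<lambda>\<mu>. chr (b j) \<mu> * cnj (chr (a k) \<mu>))" for j k
  have cB: "cnj (B j k) = ?E (\<lambda>\<mu>. chr (a k) \<mu> * cnj (chr (b j) \<mu>))" for j k
    using mean_chr_minus[of "b j - a k"] by (simp add: B_def mean_chr_diff)
  have w: "chr (b j) \<xi> = (\<Sum>k\<in>K. B j k * chr (a k) \<xi>)" if "j \<in> K" "\<xi> \<in> \<Lambda>" for j \<xi>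
  proof -
    have "(\<Sum>k\<in>K. B j k * chr (a k) \<xi>) = (\<Sum>k\<in>K. chr (a k) \<xi> * ?E (\<lambda>\<mu>. chr (b j) \<mu> * cnj (chr (a k) \<mu>)))"
      by (simp add: B_def mult.commute)
    also have "\<dots> = ?E (\<lambda>\<mu>. \<Sum>k\<in>K. chr (a k) \<xi> * (chr (b j) \<mu> * cnj (chr (a k) \<mu>)))"
      by (rule mean_sum[symmetric, where C = 1]) (auto simp: fin norm_mult)
    also have "\<dots> = ?E (\<lambda>\<mu>. chr (b j) \<mu> * (\<Sum>k\<in>K. chr (a k) \<xi> * cnj (chr (a k) \<mu>)))"
      by (simp add: sum_distrib_left mult_ac)
    \<comment> \<open>The kernel of left end points is exchanged for that of right end points, after
      which orthonormality of the right end values under the mean leaves one term.\<close>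
    also have "\<dots> = ?E (\<lambda>\<mu>. chr (b j) \<mu> * (\<Sum>k\<in>K. chr (b k) \<xi> * cnj (chr (b k) \<mu>)))"
      by (rule mean_cong) (simp add: orthogonality that)
    also have "\<dots> = ?E (\<lambda>\<mu>. \<Sum>k\<in>K. chr (b k) \<xi> * (chr (b j) \<mu> * cnj (chr (b k) \<mu>)))"
      by (simp add: sum_distrib_left mult_ac)
    also have "\<dots> = (\<Sum>k\<in>K. chr (b k) \<xi> * ?E (\<lambda>\<mu>. chr (b j) \<mu> * cnj (chr (b k) \<mu>)))"
      by (rule mean_sum[where C = 1]) (auto simp: fin norm_mult)
    also have "\<dots> = (\<Sum>k\<in>K. if j = k then chr (b k) \<xi> else 0)"
      by (rule sum.cong) (auto simp: Eb that)
    finally show ?thesis using that fin by simp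
  qed
  have v: "chr (a k) \<xi> = (\<Sum>j\<in>K. cnj (B j k) * chr (b j) \<xi>)" if "k \<in> K" "\<xi> \<in> \<Lambda>" for k \<xi>
  proof -
    have "(\<Sum>j\<in>K. cnj (B j k) * chr (b j) \<xi>) = (\<Sum>j\<in>K. chr (b j) \<xi> * ?E (\<lambda>\<mu>. chr (a k) \<mu> * cnj (chr (b j) \<mu>)))"
      by (simp add: cB mult.commute)
    also have "\<dots> = ?E (\<lambda>\<mu>. \<Sum>j\<in>K. chr (b j) \<xi> * (chr (a k) \<mu> * cnj (chr (b j) \<mu>)))"
      by (rule mean_sum[symmetric, where C = 1]) (auto simp: fin norm_mult)
    also have "\<dots> = ?E (\<lambda>\<mu>. chr (a k) \<mu> * (\<Sum>j\<in>K. chr (b j) \<xi> * cnj (chr (b j) \<mu>)))"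
      by (simp add: sum_distrib_left mult_ac)
    also have "\<dots> = ?E (\<lambda>\<mu>. chr (a k) \<mu> * (\<Sum>j\<in>K. chr (a j) \<xi> * cnj (chr (a j) \<mu>)))"
      by (rule mean_cong) (simp add: orthogonality that)
    also have "\<dots> = ?E (\<lambda>\<mu>. \<Sum>j\<in>K. chr (a j) \<xi> * (chr (a k) \<mu> * cnj (chr (a j) \<mu>)))"
      by (simp add: sum_distrib_left mult_ac)
    also have "\<dots> = (\<Sum>j\<in>K. chr (a j) \<xi> * ?E (\<lambda>\<mu>. chr (a k) \<mu> * cnj (chr (a j) \<mu>)))"
      by (rule mean_sum[where C = 1]) (auto simp: fin norm_mult)
    also have "\<dots> = (\<Sum>j\<in>K. if k = j then chr (a j) \<xi> else 0)"
      by (rule sum.cong) (auto simp: Ea that)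
    finally show ?thesis using that fin by simp
  qed
  have rows: "(\<Sum>k\<in>K. B i k * cnj (B j k)) = (if i = j then 1 else 0)" if "i \<in> K" "j \<in> K" for i j
  proof -
    have "(\<Sum>k\<in>K. B i k * cnj (B j k)) = ?E (\<lambda>\<mu>. \<Sum>k\<in>K. B i k * (chr (a k) \<mu> * cnj (chr (b j) \<mu>)))"
      unfolding cB by (rule mean_sum[symmetric, where C = 1]) (auto simp: fin norm_mult)
    also have "\<dots> = ?E (\<lambda>\<mu>. (\<Sum>k\<in>K. B i k * chr (a k) \<mu>) * cnj (chr (b j) \<mu>))"
      by (simp add: sum_distrib_right mult.assoc)
    also have "\<dots> = ?E (\<lambda>\<mu>. chr (b i) \<mu> * cnj (chr (b j) \<mu>))"
      by (rule mean_cong) (simp add: w[symmetric] that)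
    finally show ?thesis using Eb that by simp
  qed
  have cols: "(\<Sum>k\<in>K. B k i * cnj (B k j)) = (if i = j then 1 else 0)" if "i \<in> K" "j \<in> K" for i j
  proof -
    have "(\<Sum>k\<in>K. B k i * cnj (B k j)) = (\<Sum>k\<in>K. cnj (B k j) * B k i)"
      by (simp add: mult.commute)
    also have "\<dots> = ?E (\<lambda>\<mu>. \<Sum>k\<in>K. cnj (B k j) * (chr (b k) \<mu> * cnj (chr (a i) \<mu>)))"
      unfolding B_def[of _ i] by (rule mean_sum[symmetric, where C = 1]) (auto simp: fin norm_mult)
    also have "\<dots> = ?E (\<lambda>\<mu>. (\<Sum>k\<in>K. cnj (B k j) * chr (b k) \<mu>) * cnj (chr (a i) \<mu>))"
      by (simp add: sum_distrib_right mult.assoc)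
    also have "\<dots> = ?E (\<lambda>\<mu>. chr (a j) \<mu> * cnj (chr (a i) \<mu>))"
      by (rule mean_cong) (simp add: v[symmetric] that)
    finally show ?thesis using Ea that by auto
  qed
  show ?thesis
    unfolding boundary_matrix_def using w rows cols by blast
qed

text \<open>Multiply row \<open>j\<close> of the boundary relation by the conjugate of
  \<open>chr (a k)\<close> and average: only the term with index \<open>k\<close> survives. The same
  mean may kill finitely many further differences, so it can be applied to identities mixing matrix
  entries and characters.\<close>

lemma boundary_matrix_mean:
  assumes B: "boundary_matrix B" and S: "finite S" "S \<subseteq> differences"
  shows "\<exists>\<omega>. weights \<Lambda> \<omega> \<and> (\<forall>s\<in>S. mean \<Lambda> \<omega> (chr s) = 0) \<and>
    (\<forall>j\<in>K. \<forall>k\<in>K. mean \<Lambda> \<omega> (chr (b j - a k)) = B j k)"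
proof -
  define S' where "S' = S \<union> (\<lambda>(j, k). a j - a k) ` {(j, k). j \<in> K \<and> k \<in> K \<and> j \<noteq> k}"
  have "finite {(j, k). j \<in> K \<and> k \<in> K \<and> j \<noteq> k}"
    by (rule finite_subset[OF _ finite_cartesian_product[OF fin fin]]) auto
  then have fin_S: "finite S'" unfolding S'_def
    using S by simp
  have S_diff: "S' \<subseteq> differences" unfolding S'_def using a_diff S by auto
  obtain \<omega> where "weights \<Lambda> \<omega>" and \<omega>: "\<And>s. s \<in> S' \<Longrightarrow> mean \<Lambda> \<omega> (chr s) = 0"
    using ex_annihilating_weights[OF fin_S S_diff] by blast
  interpret weights \<Lambda> \<omega> by fact
  have chr0: "chr 0 = (\<lambda>_. 1)" by (simp add: fun_eq_iff)
  have Ea: "mean \<Lambda> \<omega> (chr (a j - a k)) = (if j = k then 1 else 0)" if "j \<in> K" "k \<in> K" for j k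
  proof (cases "j = k")
    case False
    then have "a j - a k \<in> S'" using that unfolding S'_def by (intro UnI2 image_eqI[of _ _ "(j, k)"]) auto
    then show ?thesis using False by (simp add: \<omega>)
  qed (simp add: mean_const chr0)
  have "mean \<Lambda> \<omega> (chr (b j - a k)) = B j k" if "j \<in> K" "k \<in> K" for j k
  proof -
    have "mean \<Lambda> \<omega> (chr (b j - a k)) = mean \<Lambda> \<omega> (\<lambda>\<mu>. \<Sum>l\<in>K. B j l * chr (a l - a k) \<mu>)"
      using B that by (intro mean_cong) (simp add: boundary_matrix_def chr_diff sum_distrib_right mult.assoc)
    also have "\<dots> = (\<Sum>l\<in>K. B j l * mean \<Lambda> \<omega> (chr (a l - a k)))"
      by (rule mean_sum[where C = 1]) (auto simp: fin)
    also have "\<dots> = (\<Sum>l\<in>K. if l = k then B j l else 0)"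
      by (rule sum.cong) (auto simp: Ea that)
    finally show ?thesis using that fin by simp
  qed
  moreover have "\<forall>s\<in>S. mean \<Lambda> \<omega> (chr s) = 0" using \<omega> unfolding S'_def by simp
  ultimately show ?thesis using \<open>weights \<Lambda> \<omega>\<close> by (intro exI[of _ \<omega>] conjI ballI) auto
qed

end

section \<open>Three intervals\<close>

context interval_spectrum
begin

lemma \<Lambda>_nonempty: "\<Lambda> \<noteq> {}"
proof
  assume "\<Lambda> = {}"
  moreover obtain \<omega> where "weights \<Lambda> \<omega>" using ex_annihilating_weights[of "{}"] by auto
  ultimately have "(\<omega> has_sum 1) {}" by (simp add: weights_def)
  then show False using has_sum_unique[OF _ has_sum_empty] by fastforce
qed

lemma shorter_difference:
  assumes "j \<in> K" "\<bar>s\<bar> < b j - a j" "s \<noteq> 0"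
  shows "s \<in> differences"
proof (cases "s > 0")
  case True
  then have "(a j + s) - a j \<in> differences"
    by (intro differencesI[where j = j and k = j]) (use assms in auto)
  then show ?thesis by simp
next
  case False
  then have "a j - (a j - s) \<in> differences"
    by (intro differencesI[where j = j and k = j]) (use assms in auto)
  then show ?thesis by simp
qed

text \<open>The annihilating mean of a constant is that constant, so it would be zero, whereas
  characters are unimodular.\<close>

lemma chr_not_constant:
  assumes "s \<in> differences"
  shows "\<not> (\<forall>\<xi>\<in>\<Lambda>. chr s \<xi> = \<kappa>)"
proof
  assume *: "\<forall>\<xi>\<in>\<Lambda>. chr s \<xi> = \<kappa>"
  obtain \<omega> where "weights \<Lambda> \<omega>" and 0: "mean \<Lambda> \<omega> (chr s) = 0"
    using ex_annihilating_weights[of "{s}"] assms by auto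
  interpret weights \<Lambda> \<omega> by fact
  have "mean \<Lambda> \<omega> (chr s) = \<kappa>"
    using mean_cong[of "chr s" "\<lambda>_. \<kappa>"] * by (simp add: mean_const)
  then have "\<kappa> = 0" using 0 by simp
  then show False using * \<Lambda>_nonempty by auto
qed

text \<open>Otherwise the exponentials of \<open>\<Lambda>\<close> would be orthogonal on the single interval \<open>j\<close>.\<close>

lemma chr_length_not_constant:
  assumes j: "j \<in> K" "b j - a j < L"
  shows "\<not> (\<forall>\<xi>\<in>\<Lambda>. chr (b j - a j) \<xi> = \<kappa>)"
proof
  assume *: "\<forall>\<xi>\<in>\<Lambda>. chr (b j - a j) \<xi> = \<kappa>"
  obtain \<mu> where \<mu>: "\<mu> \<in> \<Lambda>" using \<Lambda>_nonempty by auto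
  have sub: "{a j..<b j} \<subseteq> \<Omega>" using j by (auto simp: \<Omega>_eq)
  have le: "a j \<le> b j" using less[OF j(1)] by simp
  \<comment> \<open>Constancy makes the Fourier coefficients of interval \<open>j\<close> at the
    other frequencies vanish. Parseval then has a single term and forces the length of the interval
    to be \<open>L\<close>.\<close>
  have zero: "chr_integral (\<mu> - \<xi>) (a j) (b j) = 0" if "\<xi> \<in> \<Lambda> - {\<mu>}" for \<xi>
  proof -
    have "chr (\<mu> - \<xi>) (b j) = chr (\<mu> - \<xi>) (a j) * chr (\<mu> - \<xi>) (b j - a j)"
      by (simp flip: chr_add_right)
    also have "chr (\<mu> - \<xi>) (b j - a j) = chr (b j - a j) \<mu> * cnj (chr (b j - a j) \<xi>)"
      by (metis chr_diff_right chr_commute)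
    also have "\<dots> = 1" using * \<mu> that by (metis DiffD1 chr_mult_cnj(1))
    finally show ?thesis using that by (auto simp: chr_integral_def)
  qed
  have "((\<lambda>\<xi>. (cmod (chr_integral (\<mu> - \<xi>) (a j) (b j)))\<^sup>2 / L) has_sum (b j - a j)\<^sup>2 / L) \<Lambda>"
    by (rule has_sum_finite_neutralI[where B = "{\<mu>}"])
      (use \<mu> zero le in \<open>auto simp: chr_integral_def simp del: of_real_diff\<close>)
  then have "(b j - a j)\<^sup>2 / L = b j - a j"
    using parseval_interval[OF le sub] has_sum_unique by blast
  then have "(b j - a j) * (b j - a j) = (b j - a j) * L"
    using L_pos by (simp add: divide_eq_eq power2_eq_square)
  then show False using j less[OF j(1)] by simp
qed

lemma boundary_matrix_three:
  assumes B: "boundary_matrix B" and K: "K = {p, q, r}" "distinct [p, q, r]"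
  shows "\<xi> \<in> \<Lambda> \<Longrightarrow> j \<in> K \<Longrightarrow>
      chr (b j) \<xi> = B j p * chr (a p) \<xi> + B j q * chr (a q) \<xi> + B j r * chr (a r) \<xi>"
    and "i \<in> K \<Longrightarrow> j \<in> K \<Longrightarrow>
      B i p * cnj (B j p) + B i q * cnj (B j q) + B i r * cnj (B j r) = (if i = j then 1 else 0)"
    and "i \<in> K \<Longrightarrow> j \<in> K \<Longrightarrow>
      B p i * cnj (B p j) + B q i * cnj (B q j) + B r i * cnj (B r j) = (if i = j then 1 else 0)"
proof -
  have sum3: "(\<Sum>k\<in>K. f k) = f p + f q + f r" for f :: "nat \<Rightarrow> complex"
    using K by (simp add: add.assoc)
  from B show "\<xi> \<in> \<Lambda> \<Longrightarrow> j \<in> K \<Longrightarrow>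
      chr (b j) \<xi> = B j p * chr (a p) \<xi> + B j q * chr (a q) \<xi> + B j r * chr (a r) \<xi>"
    and "i \<in> K \<Longrightarrow> j \<in> K \<Longrightarrow>
      B i p * cnj (B j p) + B i q * cnj (B j q) + B i r * cnj (B j r) = (if i = j then 1 else 0)"
    and "i \<in> K \<Longrightarrow> j \<in> K \<Longrightarrow>
      B p i * cnj (B p j) + B q i * cnj (B q j) + B r i * cnj (B r j) = (if i = j then 1 else 0)"
    unfolding boundary_matrix_def sum3 by blast+
qed

text \<open>The mean that recovers the entry can be chosen to annihilate the very character it
  averages.\<close>

lemma boundary_matrix_entry_eq_0:
  assumes "boundary_matrix B" "j \<in> K" "k \<in> K" "b j - a k \<in> differences"
  shows "B j k = 0"
  using boundary_matrix_mean[OF assms(1), of "{b j - a k}"] assms by auto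

lemma boundary_matrix_entry_cong:
  assumes "boundary_matrix B" "i \<in> K" "j \<in> K" "k \<in> K" "l \<in> K" "b i - a j = b k - a l"
  shows "B i j = B k l"
  using boundary_matrix_mean[OF assms(1), of "{}"] assms(2-) by auto metis

end

text \<open>Two points determine an affine function. The variable is \<open>cnj z\<close> because a
  power of \<open>chr h\<close> then turns into exponents 0 and \<open>- h\<close>, and both stay
  shorter than \<open>h\<close> after adding an offset strictly between 0 and
  \<open>h\<close>.\<close>

lemma affine_interpolation:
  fixes s t :: complex
  assumes "s \<noteq> t"
  shows "\<exists>\<alpha> \<beta>. \<forall>z\<in>{s, t}. f z = \<alpha> + \<beta> * cnj z"
proof -
  define \<beta> where "\<beta> = (f s - f t) / (cnj s - cnj t)"
  have "cnj s - cnj t \<noteq> 0" using assms by simp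
  then have "f s - f t = \<beta> * (cnj s - cnj t)" by (simp add: \<beta>_def)
  then have "f s = (f t - \<beta> * cnj t) + \<beta> * cnj s" "f t = (f t - \<beta> * cnj t) + \<beta> * cnj t"
    by (simp_all add: algebra_simps)
  then show ?thesis by blast
qed

lemma chr_of_int_mult: "chr (of_int n * h) x = chr h x powi n"
  unfolding chr_def cis_power_int by (simp add: mult_ac)

text \<open>The two summands must be perpendicular, which determines \<open>\<rho>\<close> up to sign.\<close>

lemma unimodular_combination:
  fixes u v \<rho> :: complex
  assumes "u * cnj u + v * cnj v = 1" "u \<noteq> 0" "v \<noteq> 0"
    and "\<rho> * cnj \<rho> = 1" "(u * \<rho> + v) * cnj (u * \<rho> + v) = 1"
  shows "\<rho>\<^sup>2 = - (v * cnj u) / (u * cnj v)"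
proof -
  have "u * cnj u * (\<rho> * cnj \<rho>) + v * cnj v + (u * \<rho> * cnj v + v * cnj u * cnj \<rho>) = 1"
    using assms(5) by (simp add: algebra_simps)
  then have "u * \<rho> * cnj v + v * cnj u * cnj \<rho> = 0"
    using assms(1,4) by simp
  then have "(u * \<rho> * cnj v + v * cnj u * cnj \<rho>) * \<rho> = 0"
    by simp
  then have "u * cnj v * \<rho>\<^sup>2 + v * cnj u * (\<rho> * cnj \<rho>) = 0"
    by (simp add: algebra_simps power2_eq_square)
  then have "u * cnj v * \<rho>\<^sup>2 = - (v * cnj u)"
    using assms(4) by (simp add: add_eq_0_iff)
  then show ?thesis using assms(2,3) by (simp add: field_simps)
qed

context interval_spectrum
begin

text \<open>Row \<open>p\<close> has one entry, of modulus 1, which clears the rest of column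
  \<open>q\<close> and leaves a unitary block with rows \<open>q\<close>, \<open>r\<close> and
  columns \<open>p\<close>, \<open>r\<close>. If \<open>c\<close> vanishes, the matrix permutes the
  intervals cyclically; if \<open>R\<close> vanishes, the character of the length of
  \<open>r\<close> is constant, which is impossible. In the mixed case two explicit exponents must
  degenerate, one to 0 and one to a multiple of the length of \<open>r\<close>.\<close>

lemma monomial_row:
  assumes B: "boundary_matrix B" and K: "K = {p, q, r}" "distinct [p, q, r]"
    and 0: "B p p = 0" "B q q = 0" "B p r = 0"
    and len: "b p - a p + (b q - a q) < 2 * (b r - a r)" and L: "b r - a r < L"
  shows "(\<exists>\<kappa>. \<forall>\<xi>\<in>\<Lambda>. chr (\<Sum>j\<in>K. b j - a j) \<xi> = \<kappa>) \<or>
    b r - a r = b p - a p + (b q - a q) \<and> (\<exists>n::int. b p - a q = of_int n * (b r - a r))"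
proof -
  note row = boundary_matrix_three(2)[OF B K] and col = boundary_matrix_three(3)[OF B K]
    and w = boundary_matrix_three(1)[OF B K]
  define x P Q R c where defs: "x = B p q" "P = B q p" "Q = B q r" "R = B r p" "c = B r r"
  have x: "x * cnj x = 1"
    using row[of p p] K 0 by (simp add: defs)
  have "x * cnj x + B r q * cnj (B r q) = 1"
    using col[of q q] K 0 by (simp add: defs)
  then have rq: "B r q = 0" using x by simp
  have PQ: "P * cnj P + Q * cnj Q = 1" and Rc: "R * cnj R + c * cnj c = 1"
    and orth: "P * cnj R + Q * cnj c = 0"
    using row[of q q] row[of r r] row[of q r] K 0 rq by (simp_all add: defs)
  have wp: "chr (b p) \<xi> = x * chr (a q) \<xi>"
    and wq: "chr (b q) \<xi> = P * chr (a p) \<xi> + Q * chr (a r) \<xi>"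
    and wr: "chr (b r) \<xi> = R * chr (a p) \<xi> + c * chr (a r) \<xi>" if "\<xi> \<in> \<Lambda>" for \<xi>
    using w[OF that, of p] w[OF that, of q] w[OF that, of r] K 0 rq by (simp_all add: defs)
  consider "c = 0" | "R = 0" | "c \<noteq> 0" "R \<noteq> 0" by blast
  then show ?thesis
  proof cases
    case 1
    then have "R \<noteq> 0" using Rc by auto
    then have "P = 0" using orth 1 by simp
    have "chr (\<Sum>j\<in>K. b j - a j) \<xi> = x * Q * R" if "\<xi> \<in> \<Lambda>" for \<xi>
    proof -
      \<comment> \<open>The total length is regrouped along the cycle, so that each difference
        corresponds to a nonzero matrix entry.\<close>
      have "(\<Sum>j\<in>K. b j - a j) = (b p - a q) + (b q - a r) + (b r - a p)"
        using K by simp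
      then show ?thesis
        using wp[OF that] wq[OF that] wr[OF that] 1 \<open>P = 0\<close>
        by (simp add: chr_add chr_diff mult.assoc)
    qed
    then show ?thesis by blast
  next
    case 2
    have "chr (b r - a r) \<xi> = c" if "\<xi> \<in> \<Lambda>" for \<xi>
      using wr[OF that] 2 by (simp add: chr_diff mult.assoc)
    then show ?thesis using chr_length_not_constant[of r c] K L by blast
  next
    case 3
    define \<sigma> where "\<sigma> = - (c * cnj R) / (R * cnj c)"
    define \<rho> where "\<rho> = chr (a p - a r)"
    define h where "h = b r - a r"
    have "cmod \<sigma> = 1"
      using 3 by (simp add: \<sigma>_def norm_divide norm_mult)
    have z3: "chr h \<xi> = R * \<rho> \<xi> + c" if "\<xi> \<in> \<Lambda>" for \<xi>
      using wr[OF that] by (simp add: h_def \<rho>_def chr_diff ring_distribs mult.assoc)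
    have \<rho>2: "(\<rho> \<xi>)\<^sup>2 = \<sigma>" if "\<xi> \<in> \<Lambda>" for \<xi>
      unfolding \<sigma>_def
    proof (rule unimodular_combination[OF Rc])
      show "(R * \<rho> \<xi> + c) * cnj (R * \<rho> \<xi> + c) = 1"
        unfolding z3[OF that, symmetric] by (rule chr_mult_cnj)
    qed (use 3 in \<open>simp_all add: \<rho>_def\<close>)
    \<comment> \<open>By orthogonality of rows \<open>q\<close> and \<open>r\<close>, the product of
      the remaining factors is a difference of two squares. It involves the conjugate of
      \<open>\<rho>\<close> only through its square, which is constant.\<close>
    define \<eta> where "\<eta> = x * P / cnj c * ((cnj c)\<^sup>2 - (cnj R)\<^sup>2 * cnj \<sigma>)"
    have "chr (b p - a p + (b q - a q) - h) \<xi> = \<eta>" if "\<xi> \<in> \<Lambda>" for \<xi>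
    proof -
      have Q: "Q = - (P * cnj R) / cnj c"
        using orth 3 by (simp add: field_simps add_eq_0_iff2)
      have "b p - a p + (b q - a q) - h = (b p - a q) + (b q - a p) - h" by simp
      then have "chr (b p - a p + (b q - a q) - h) \<xi>
         = (chr (b p - a q) \<xi> * (chr (b q - a p) \<xi>)) * cnj (chr h \<xi>)"
        by (simp only: chr_add chr_diff)
      also have "chr (b p - a q) \<xi> = x"
        using wp[OF that] by (simp add: chr_diff mult.assoc)
      also have "chr (b q - a p) \<xi> = P + Q * cnj (\<rho> \<xi>)"
        using wq[OF that] by (simp add: chr_diff \<rho>_def ring_distribs mult.assoc mult.commute[of _ "chr (a r) \<xi>"])
      also have "x * (P + Q * cnj (\<rho> \<xi>)) * cnj (chr h \<xi>)
        = x * P / cnj c * ((cnj c)\<^sup>2 - (cnj R)\<^sup>2 * cnj ((\<rho> \<xi>)\<^sup>2))"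
        using 3 by (simp add: Q z3[OF that] field_simps power2_eq_square)
      finally show ?thesis by (simp add: \<rho>2[OF that] \<eta>_def)
    qed
    then have "b p - a p + (b q - a q) - h \<notin> differences"
      using chr_not_constant[of "b p - a p + (b q - a q) - h" \<eta>] by blast
    \<comment> \<open>The exponent is shorter than interval \<open>r\<close>; were it nonzero, it
      would be a difference with a constant character.\<close>
    moreover have "\<bar>b p - a p + (b q - a q) - h\<bar> < b r - a r"
      using len less[of p] less[of q] K by (auto simp: h_def)
    ultimately have sum: "b p - a p + (b q - a q) = h"
      using shorter_difference[of r] K by fastforce
    have "\<exists>n::int. b p - a q = of_int n * h"
    proof (rule ccontr)
      assume no: "\<nexists>n::int. b p - a q = of_int n * h"
      \<comment> \<open>Division with remainder: both \<open>u\<close> and \<open>u - h\<close> are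
        nonzero and shorter than interval \<open>r\<close>, so one mean kills both
        characters.\<close>
      define n where "n = \<lfloor>(b p - a q) / h\<rfloor>"
      define u where "u = b p - a q - of_int n * h"
      have "h > 0" using less[of r] K by (simp add: h_def)
      have "of_int n * h \<le> b p - a q" "b p - a q < (of_int n + 1) * h"
        using floor_divide_lower[OF \<open>h > 0\<close>, of "b p - a q"]
          floor_divide_upper[OF \<open>h > 0\<close>, of "b p - a q"] unfolding n_def by simp_all
      moreover have "u \<noteq> 0" using no by (auto simp: u_def)
      ultimately have u: "0 < u" "u < h" by (auto simp: u_def algebra_simps)
      have diffs: "u \<in> differences" "u - h \<in> differences"
        using u K by (auto intro!: shorter_difference[of r] simp: h_def)
      \<comment> \<open>As \<open>R * \<rho> \<xi>\<close> is a square root of a constant,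
        \<open>chr h\<close> takes at most the two values \<open>c + t\<close> and
        \<open>c - t\<close> on the spectrum.\<close>
      define t where "t = R * csqrt \<sigma>"
      have "t \<noteq> 0" using 3 \<open>cmod \<sigma> = 1\<close> by (auto simp: t_def)
      then have "c + t \<noteq> c - t" by simp
      then obtain \<alpha> \<beta> where interp: "\<And>z. z \<in> {c + t, c - t} \<Longrightarrow> z powi n = \<alpha> + \<beta> * cnj z"
        using affine_interpolation[of "c + t" "c - t" "\<lambda>z. z powi n"] by blast
      have "chr h \<xi> \<in> {c + t, c - t}" if "\<xi> \<in> \<Lambda>" for \<xi>
      proof -
        have "(R * \<rho> \<xi>)\<^sup>2 = t\<^sup>2" using \<rho>2[OF that] by (simp add: t_def power_mult_distrib)
        then have "R * \<rho> \<xi> = t \<or> R * \<rho> \<xi> = - t" by (simp add: power2_eq_iff)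
        then show ?thesis using z3[OF that] by auto
      qed
      then have chr_n: "chr (of_int n * h) \<xi> = \<alpha> + \<beta> * cnj (chr h \<xi>)" if "\<xi> \<in> \<Lambda>" for \<xi>
        using interp that by (simp add: chr_of_int_mult)
      have chr_s: "chr (b p - a q) \<xi> = chr u \<xi> * chr (of_int n * h) \<xi>" for \<xi>
        by (simp add: u_def flip: chr_add)
      \<comment> \<open>The unimodular constant \<open>x\<close> becomes a combination of two
        characters that have mean zero.\<close>
      have eq: "x = \<alpha> * chr u \<xi> + \<beta> * chr (u - h) \<xi>" if "\<xi> \<in> \<Lambda>" for \<xi>
      proof -
        have "x = chr (b p - a q) \<xi>"
          using wp[OF that] by (simp add: chr_diff mult.assoc)
        also have "\<dots> = chr u \<xi> * (\<alpha> + \<beta> * cnj (chr h \<xi>))"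
          by (simp only: chr_n[OF that] chr_s)
        finally show ?thesis by (simp add: chr_diff algebra_simps)
      qed
      obtain \<omega> where "weights \<Lambda> \<omega>" and \<omega>: "mean \<Lambda> \<omega> (chr u) = 0" "mean \<Lambda> \<omega> (chr (u - h)) = 0"
        using ex_annihilating_weights[of "{u, u - h}"] diffs by auto
      interpret weights \<Lambda> \<omega> by fact
      have "x = mean \<Lambda> \<omega> (\<lambda>\<xi>. \<alpha> * chr u \<xi> + \<beta> * chr (u - h) \<xi>)"
        using mean_cong[of "\<lambda>_. x", OF eq] by (simp add: mean_const)
      also have "\<dots> = mean \<Lambda> \<omega> (\<lambda>\<xi>. \<alpha> * chr u \<xi>) + mean \<Lambda> \<omega> (\<lambda>\<xi>. \<beta> * chr (u - h) \<xi>)"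
        by (rule mean_add[of _ "cmod \<alpha>" _ "cmod \<beta>"]) (auto simp: norm_mult)
      also have "\<dots> = 0" by (simp add: mean_cmult \<omega>)
      finally show False using x by simp
    qed
    then show ?thesis using sum by (simp add: h_def)
  qed
qed

text \<open>The quotient \<open>\<rho>\<close> of the boundary values at \<open>a q\<close> and \<open>a r\<close> takes only two opposite values,
  so the boundary values at the other end points are affine in \<open>\<rho>\<close> and their means are explicit.\<close>

lemma two_longest_diagonal_eq_0:
  assumes B: "boundary_matrix B" and K: "K = {p, q, r}" "distinct [p, q, r]"
    and len: "b p - a p < b r - a r" "b q - a q = b r - a r"
  shows "B q q = 0"
proof (rule ccontr)
  note row = boundary_matrix_three(2)[OF B K] and col = boundary_matrix_three(3)[OF B K]
    and w = boundary_matrix_three(1)[OF B K]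
  define M where "M = b r - a r"
  define x y s d e t f where defs: "x = B p q" "y = B p r" "s = B q p" "d = B q q" "e = B q r"
    "t = B r p" "f = B r q"
  assume "B q q \<noteq> 0"
  then have d: "d \<noteq> 0" by (simp add: defs)
  have lp: "b p - a p > 0" using less[of p] K by simp
  have pp: "B p p = 0"
    using K len lp by (intro boundary_matrix_entry_eq_0[OF B] shorter_difference[of r]) auto
  \<comment> \<open>Intervals \<open>q\<close> and \<open>r\<close> have equal lengths, and an entry
    of \<open>B\<close> depends only on the exponent \<open>b j - a k\<close>.\<close>
  have rr: "B r r = d"
    unfolding defs using K len by (intro boundary_matrix_entry_cong[OF B]) auto
  have xy: "x * cnj x + y * cnj y = 1" and st: "s * cnj s + t * cnj t = 1"
    and colq: "x * cnj x + d * cnj d + f * cnj f = 1" and colr: "y * cnj y + e * cnj e + d * cnj d = 1"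
    and rowq: "s * cnj s + d * cnj d + e * cnj e = 1" and rowr: "t * cnj t + f * cnj f + d * cnj d = 1"
    and pq: "cnj s * d + cnj t * f = 0" "cnj s * e + cnj t * d = 0"
    using row[of p p] col[of p p] col[of q q] col[of r r] row[of q q] row[of r r]
      col[of q p] col[of r p] K pp rr by (simp_all add: defs mult.commute)
  have cmod_eq: "z * cnj z = of_real ((cmod z)\<^sup>2)" for z
    by (rule complex_norm_square[symmetric])
  have sq: "(cmod x)\<^sup>2 + (cmod y)\<^sup>2 = 1" "(cmod x)\<^sup>2 + (cmod d)\<^sup>2 + (cmod f)\<^sup>2 = 1"
    "(cmod y)\<^sup>2 + (cmod e)\<^sup>2 + (cmod d)\<^sup>2 = 1" "(cmod s)\<^sup>2 + (cmod t)\<^sup>2 = 1"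
    "(cmod s)\<^sup>2 + (cmod d)\<^sup>2 + (cmod e)\<^sup>2 = 1" "(cmod t)\<^sup>2 + (cmod f)\<^sup>2 + (cmod d)\<^sup>2 = 1"
    using xy colq colr st rowq rowr unfolding cmod_eq of_real_add[symmetric] of_real_eq_1_iff by simp_all
  have "(cmod d)\<^sup>2 > 0" using d by simp
  \<comment> \<open>Comparing row \<open>p\<close> with columns \<open>q\<close> and
    \<open>r\<close>, the squared modulus of \<open>y\<close> is that of \<open>d\<close> plus that
    of \<open>f\<close>, and the squared modulus of \<open>x\<close> is that of \<open>d\<close>
    plus that of \<open>e\<close>.\<close>
  then have "(cmod x)\<^sup>2 \<noteq> 0" "(cmod y)\<^sup>2 \<noteq> 0"
    using sq(1-3) zero_le_power2[of "cmod e"] zero_le_power2[of "cmod f"] by linarith+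
  then have x0: "x \<noteq> 0" and y0: "y \<noteq> 0" by auto
  define \<rho> where "\<rho> = chr (a q - a r)"
  define \<sigma> where "\<sigma> = - (y * cnj x) / (x * cnj y)"
  \<comment> \<open>This constant appears when \<open>chr M\<close> is eliminated from the relations
    for rows \<open>q\<close> and \<open>r\<close>.\<close>
  define C where "C = f * \<sigma> - e"
  have wp: "chr (b p - a r) \<xi> = x * \<rho> \<xi> + y" if "\<xi> \<in> \<Lambda>" for \<xi>
    using w[OF that, of p] K pp by (simp add: defs \<rho>_def chr_diff ring_distribs mult.assoc)
  have \<rho>1: "\<rho> \<xi> * cnj (\<rho> \<xi>) = 1" for \<xi> by (simp add: \<rho>_def)
  have \<rho>2: "(\<rho> \<xi>)\<^sup>2 = \<sigma>" if "\<xi> \<in> \<Lambda>" for \<xi>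
    unfolding \<sigma>_def
    by (rule unimodular_combination) (use xy x0 y0 \<rho>1 in \<open>simp_all flip: wp[OF that]\<close>)
  have cnj_\<rho>: "cnj (\<rho> \<xi>) = cnj \<sigma> * \<rho> \<xi>" if "\<xi> \<in> \<Lambda>" for \<xi>
  proof -
    have "cnj \<sigma> * \<rho> \<xi> = cnj (\<rho> \<xi>) * (\<rho> \<xi> * cnj (\<rho> \<xi>))"
      using \<rho>2[OF that] by (auto simp: power2_eq_square)
    then show ?thesis by (simp add: \<rho>1)
  qed
  define \<nu> where "\<nu> = chr (a p - a r)"
  have \<nu>1: "\<nu> \<xi> * cnj (\<nu> \<xi>) = 1" for \<xi> by (simp add: \<nu>_def)
  have wq: "\<rho> \<xi> * chr M \<xi> = s * \<nu> \<xi> + d * \<rho> \<xi> + e" if "\<xi> \<in> \<Lambda>" for \<xi>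
  proof -
    have "a q - a r + M = b q - a r" using len by (simp add: M_def)
    then have "\<rho> \<xi> * chr M \<xi> = chr (b q - a r) \<xi>"
      using chr_add[of "a q - a r" M \<xi>] by (simp only: \<rho>_def)
    then show ?thesis
      using w[OF that, of q] K by (simp add: defs \<rho>_def \<nu>_def chr_diff ring_distribs mult.assoc)
  qed
  have wr: "chr M \<xi> = t * \<nu> \<xi> + f * \<rho> \<xi> + d" if "\<xi> \<in> \<Lambda>" for \<xi>
    using w[OF that, of r] K rr by (simp add: defs M_def \<rho>_def \<nu>_def chr_diff ring_distribs mult.assoc)
  have \<nu>C: "(s - \<rho> \<xi> * t) * \<nu> \<xi> = C" if "\<xi> \<in> \<Lambda>" for \<xi>
  proof -
    have "\<rho> \<xi> * (t * \<nu> \<xi> + f * \<rho> \<xi> + d) = s * \<nu> \<xi> + d * \<rho> \<xi> + e"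
      using wq[OF that] wr[OF that] by simp
    then show ?thesis unfolding C_def \<rho>2[OF that, symmetric] by (simp add: algebra_simps power2_eq_square)
  qed
  \<comment> \<open>Column \<open>p\<close> expresses \<open>\<nu>\<close> as
    \<open>cnj s * \<rho> \<xi> + cnj t\<close> times a unimodular number. That factor has modulus
    1, so its cross term vanishes, and the same cross term with opposite sign is the one needed
    here.\<close>
  have "(s - \<rho> \<xi> * t) * cnj (s - \<rho> \<xi> * t) = 1" if "\<xi> \<in> \<Lambda>" for \<xi>
  proof -
    have "cnj s * (\<rho> \<xi> * chr M \<xi>) + cnj t * chr M \<xi> = (s * cnj s + t * cnj t) * \<nu> \<xi>
        + (cnj s * d + cnj t * f) * \<rho> \<xi> + (cnj s * e + cnj t * d)"
      unfolding wq[OF that] by (subst wr[OF that]) (simp add: algebra_simps)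
    then have "cnj s * (\<rho> \<xi> * chr M \<xi>) + cnj t * chr M \<xi> = \<nu> \<xi>"
      unfolding st pq by simp
    then have v: "(cnj s * \<rho> \<xi> + cnj t) * chr M \<xi> = \<nu> \<xi>"
      by (simp add: algebra_simps)
    have "1 = (cnj s * \<rho> \<xi> + cnj t) * cnj (cnj s * \<rho> \<xi> + cnj t)"
    proof -
      have "(z * u) * cnj (z * u) = (z * cnj z) * (u * cnj u)" for z u :: complex
        by simp
      then show ?thesis using \<nu>1[of \<xi>] unfolding v[symmetric] by (simp only: chr_mult_cnj mult_1_right)
    qed
    also have "\<dots> = (s * cnj s + t * cnj t) + (cnj s * t * \<rho> \<xi> + s * cnj t * cnj (\<rho> \<xi>))"
      using \<rho>1[of \<xi>] by (simp add: algebra_simps)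
    finally have "cnj s * t * \<rho> \<xi> + s * cnj t * cnj (\<rho> \<xi>) = 0"
      using st by simp
    moreover have "(s - \<rho> \<xi> * t) * cnj (s - \<rho> \<xi> * t)
       = (s * cnj s + t * cnj t * (\<rho> \<xi> * cnj (\<rho> \<xi>))) - (cnj s * t * \<rho> \<xi> + s * cnj t * cnj (\<rho> \<xi>))"
      by (simp add: algebra_simps)
    ultimately show ?thesis using st \<rho>1[of \<xi>] by simp
  qed
  then have \<nu>_eq: "\<nu> \<xi> = C * cnj (s - \<rho> \<xi> * t)" if "\<xi> \<in> \<Lambda>" for \<xi>
    using that unfolding \<nu>C[OF that, symmetric] by (simp add: mult_ac del: complex_cnj_diff) 
  define \<alpha>1 \<beta>1 where ab1: "\<alpha>1 = cnj C * (y * s - x * t * \<sigma>)" "\<beta>1 = cnj C * (x * s - y * t)"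
  have z1: "chr (b p - a p) \<xi> = \<alpha>1 + \<beta>1 * \<rho> \<xi>" if "\<xi> \<in> \<Lambda>" for \<xi>
  proof -
    have "chr (b p - a p) \<xi> = chr (b p - a r) \<xi> * cnj (\<nu> \<xi>)"
      by (simp add: \<nu>_def flip: chr_diff)
    also have "\<dots> = (x * \<rho> \<xi> + y) * (cnj C * (s - \<rho> \<xi> * t))"
      unfolding wp[OF that] \<nu>_eq[OF that] by simp
    also have "\<dots> = \<alpha>1 + \<beta>1 * \<rho> \<xi>"
      unfolding ab1 \<rho>2[OF that, symmetric] by (simp add: algebra_simps power2_eq_square)
    finally show ?thesis .
  qed
  define \<alpha>3 \<beta>3 where ab3: "\<alpha>3 = t * C * cnj s + d" "\<beta>3 = f - t * C * cnj t * cnj \<sigma>"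
  have z3: "chr M \<xi> = \<alpha>3 + \<beta>3 * \<rho> \<xi>" if "\<xi> \<in> \<Lambda>" for \<xi>
    unfolding wr[OF that] \<nu>_eq[OF that] ab3 by (simp add: cnj_\<rho>[OF that] algebra_simps)
  \<comment> \<open>The mean must kill \<open>\<rho>\<close>, its conjugate, the character of the
    short length, and that of the excess of the long length over it.\<close>
  have "a q - a r \<in> differences" "a r - a q \<in> differences" using a_diff K by auto
  moreover have "b p - a p \<in> differences" "M - (b p - a p) \<in> differences"
    using K len lp by (auto simp: M_def intro!: shorter_difference[of r])
  ultimately obtain \<omega> where "weights \<Lambda> \<omega>" and \<omega>: "mean \<Lambda> \<omega> \<rho> = 0" "mean \<Lambda> \<omega> (chr (a r - a q)) = 0"
    "mean \<Lambda> \<omega> (chr (b p - a p)) = 0" "mean \<Lambda> \<omega> (chr (M - (b p - a p))) = 0"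
    and \<omega>B: "mean \<Lambda> \<omega> (chr (b r - a r)) = B r r"
    using boundary_matrix_mean[OF B, of "{a q - a r, a r - a q, b p - a p, M - (b p - a p)}"] K
    unfolding \<rho>_def by auto
  interpret weights \<Lambda> \<omega> by fact
  have affine: "mean \<Lambda> \<omega> (\<lambda>\<xi>. \<alpha> + \<beta> * g \<xi>) = \<alpha> + \<beta> * mean \<Lambda> \<omega> g" if "\<And>\<xi>. cmod (g \<xi>) \<le> 1" for \<alpha> \<beta> g
  proof -
    have "mean \<Lambda> \<omega> (\<lambda>\<xi>. \<alpha> + \<beta> * g \<xi>) = mean \<Lambda> \<omega> (\<lambda>_. \<alpha>) + mean \<Lambda> \<omega> (\<lambda>\<xi>. \<beta> * g \<xi>)"
      by (rule mean_add[of _ "cmod \<alpha>" _ "cmod \<beta>"]) (use that in \<open>auto simp: norm_mult mult_left_le\<close>)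
    then show ?thesis by (simp add: mean_const mean_cmult)
  qed
  have n\<rho>: "cmod (\<rho> \<xi>) \<le> 1" "cmod (chr (a r - a q) \<xi>) \<le> 1" for \<xi> by (simp_all add: \<rho>_def)
  have "\<alpha>1 = 0"
    using mean_cong[OF z1] affine[OF n\<rho>(1)] \<omega> by simp
  \<comment> \<open>With \<open>\<alpha>1 = 0\<close> the character of the short length is a
    multiple of \<open>\<rho>\<close>. Hence that of the excess is affine in the conjugate of
    \<open>\<rho>\<close>, and its vanishing mean is the constant term.\<close>
  have "chr (M - (b p - a p)) \<xi> = cnj \<beta>1 * \<beta>3 + cnj \<beta>1 * \<alpha>3 * chr (a r - a q) \<xi>" if "\<xi> \<in> \<Lambda>" for \<xi>
  proof -
    have "chr (M - (b p - a p)) \<xi> = (\<alpha>3 + \<beta>3 * \<rho> \<xi>) * cnj (\<beta>1 * \<rho> \<xi>)"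
      using z1[OF that] z3[OF that] \<open>\<alpha>1 = 0\<close> by (simp add: chr_diff)
    also have "\<dots> = cnj \<beta>1 * \<beta>3 * (\<rho> \<xi> * cnj (\<rho> \<xi>)) + cnj \<beta>1 * \<alpha>3 * cnj (\<rho> \<xi>)"
      by (simp add: algebra_simps)
    also have "cnj (\<rho> \<xi>) = chr (a r - a q) \<xi>" by (simp add: \<rho>_def cnj_chr)
    also have "\<rho> \<xi> * chr (a r - a q) \<xi> = 1" by (simp add: \<rho>_def flip: chr_add)
    finally show ?thesis by simp
  qed
  from mean_cong[OF this] affine[OF n\<rho>(2)] \<omega> have "cnj \<beta>1 * \<beta>3 = 0" by simp
  obtain \<mu> where \<mu>: "\<mu> \<in> \<Lambda>" using \<Lambda>_nonempty by auto
  have "\<beta>1 \<noteq> 0" using z1[OF \<mu>] \<open>\<alpha>1 = 0\<close> by auto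
  with \<open>cnj \<beta>1 * \<beta>3 = 0\<close> have "\<beta>3 = 0" by simp
  \<comment> \<open>A constant character equals its mean, the entry \<open>d\<close>. So
    \<open>d\<close> has modulus 1 and clears \<open>s\<close> and \<open>t\<close>, contrary to
    column \<open>p\<close> having norm 1.\<close>
  then have "chr M \<xi> = \<alpha>3" if "\<xi> \<in> \<Lambda>" for \<xi> using z3[OF that] by simp
  with mean_cong[of "chr M" "\<lambda>_. \<alpha>3"] have "B r r = \<alpha>3" "cmod \<alpha>3 = 1"
    using \<omega>B norm_chr[of M \<mu>] \<mu> by (simp_all add: M_def mean_const del: norm_chr)
  then have "cmod d = 1" using rr by simp
  then have "(cmod s)\<^sup>2 \<le> 0" "(cmod t)\<^sup>2 \<le> 0"
    using sq(5,6) zero_le_power2[of "cmod e"] zero_le_power2[of "cmod f"] by simp_all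
  then show False using sq(4) by linarith
qed

end


section \<open>Classification by length and the packing property\<close>

context interval_spectrum
begin

lemma three_interval_classification:
  assumes card: "card K = 3" and L: "L = (\<Sum>j\<in>K. b j - a j)"
  shows "(\<exists>\<kappa>. \<forall>\<xi>\<in>\<Lambda>. chr L \<xi> = \<kappa>) \<or> (\<exists>h. \<forall>j\<in>K. b j - a j = h) \<or>
    (\<exists>p q r. K = {p, q, r} \<and> distinct [p, q, r] \<and> b r - a r = b p - a p + (b q - a q) \<and>
       (\<exists>n::int. b p - a q = of_int n * (b r - a r)))"
proof -
  define l where "l j = b j - a j" for j
  obtain x y z where "K = {x, y, z}" "x \<noteq> y" "y \<noteq> z" "x \<noteq> z"
    using card unfolding card_3_iff by blast
  then have xyz: "K = {x, y, z}" "distinct [x, y, z]" by simp_all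
  have "\<exists>p q r. K = {p, q, r} \<and> distinct [p, q, r] \<and> l p \<le> l q \<and> l q \<le> l r"
  proof -
    have perms: "K = {x, z, y}" "K = {y, x, z}" "K = {y, z, x}" "K = {z, x, y}" "K = {z, y, x}"
      unfolding xyz(1) by auto
    have ex: ?thesis if "K = {u, v, w}" "distinct [u, v, w]" "l u \<le> l v \<and> l v \<le> l w" for u v w
      using that by blast
    consider "l x \<le> l y \<and> l y \<le> l z" | "l x \<le> l z \<and> l z \<le> l y" | "l y \<le> l x \<and> l x \<le> l z"
      | "l y \<le> l z \<and> l z \<le> l x" | "l z \<le> l x \<and> l x \<le> l y" | "l z \<le> l y \<and> l y \<le> l x"
      by linarith
    then show ?thesis
    proof cases
      case 1 then show ?thesis by (intro ex[OF xyz(1)]) (use xyz(2) in auto)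
    next
      case 2 then show ?thesis by (intro ex[OF perms(1)]) (use xyz(2) in auto)
    next
      case 3 then show ?thesis by (intro ex[OF perms(2)]) (use xyz(2) in auto)
    next
      case 4 then show ?thesis by (intro ex[OF perms(3)]) (use xyz(2) in auto)
    next
      case 5 then show ?thesis by (intro ex[OF perms(4)]) (use xyz(2) in auto)
    next
      case 6 then show ?thesis by (intro ex[OF perms(5)]) (use xyz(2) in auto)
    qed
  qed
  then obtain p q r where K: "K = {p, q, r}" "distinct [p, q, r]" and sorted: "l p \<le> l q" "l q \<le> l r"
    by blast
  have pos: "l p > 0" "l q > 0" "l r > 0"
    using less K(1) by (simp_all add: l_def)
  show ?thesis
  proof (cases "l p = l r")
    case True
    then have "l p = l r" "l q = l r" using sorted by simp_all
    then have "\<forall>j\<in>K. b j - a j = l r" unfolding K(1) l_def by simp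
    then show ?thesis by blast
  next
    case False
    then have lt: "l p < l r" using sorted by simp
    obtain B where B: "boundary_matrix B" using ex_boundary_matrix by blast
    have Bp: "B p p = 0"
      using K lt pos by (intro boundary_matrix_entry_eq_0[OF B] shorter_difference[of r]) (auto simp: l_def)
    have Bq: "B q q = 0"
    proof (cases "l q = l r")
      case True
      then show ?thesis using two_longest_diagonal_eq_0[OF B K] lt by (simp add: l_def)
    next
      case False
      then show ?thesis
        using K sorted pos by (intro boundary_matrix_entry_eq_0[OF B] shorter_difference[of r]) (auto simp: l_def)
    qed
    have K': "K = {q, p, r}" "distinct [q, p, r]" using K by auto
    have len: "b p - a p + (b q - a q) < 2 * (b r - a r)" "b q - a q + (b p - a p) < 2 * (b r - a r)"
      using lt sorted by (simp_all add: l_def)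
    have "L = l p + (l q + l r)" using K by (simp add: L l_def)
    then have lr: "b r - a r < L" using pos by (simp add: l_def)
    \<comment> \<open>Rows \<open>p\<close> and \<open>q\<close> are orthogonal, and their zero
      diagonal entries leave only the contribution of column \<open>r\<close>. The two resulting
      cases differ by exchanging \<open>p\<close> and \<open>q\<close>.\<close>
    have "B p r * cnj (B q r) = 0"
      using boundary_matrix_three(2)[OF B K, of p q] K Bp Bq by simp
    then consider "B p r = 0" | "B q r = 0" by auto
    then show ?thesis
    proof cases
      case 1
      from monomial_row[OF B K Bp Bq 1 len(1) lr] show ?thesis
      proof
        assume "b r - a r = b p - a p + (b q - a q) \<and> (\<exists>n::int. b p - a q = of_int n * (b r - a r))"
        with K show ?thesis by metis
      qed (simp only: L, blast)
    next
      case 2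
      from monomial_row[OF B K' Bq Bp 2 len(2) lr] show ?thesis
      proof
        assume "b r - a r = b q - a q + (b p - a p) \<and> (\<exists>n::int. b q - a p = of_int n * (b r - a r))"
        with K' show ?thesis by metis
      qed (simp only: L, blast)
    qed
  qed
qed

text \<open>Distinct points would make \<open>of_int n * h\<close> a difference, although its
  character is a power of the constant one.\<close>

lemma lattice_packing:
  assumes "\<forall>\<xi>\<in>\<Lambda>. chr h \<xi> = \<kappa>" "x \<in> \<Omega>" "y \<in> \<Omega>" "x - y = of_int n * h"
  shows "x = y"
proof (rule ccontr)
  assume "x \<noteq> y"
  then have "of_int n * h \<in> differences"
    unfolding assms(4)[symmetric] differences_def using assms(2,3) by auto
  moreover have "\<forall>\<xi>\<in>\<Lambda>. chr (of_int n * h) \<xi> = \<kappa> powi n"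
    using assms(1) by (simp add: chr_of_int_mult)
  ultimately show False using chr_not_constant by blast
qed

end

section \<open>Lattice tilings\<close>

lemma translate_into_period:
  fixes h :: real
  assumes "h > 0"
  obtains n :: int where "x + of_int n * h \<in> {a..<a + h}"
proof
  have "of_int \<lfloor>(x - a) / h\<rfloor> * h \<le> x - a" "x - a < (of_int \<lfloor>(x - a) / h\<rfloor> + 1) * h"
    using floor_divide_lower[OF assms] floor_divide_upper[OF assms] by simp_all
  then show "x + of_int (- \<lfloor>(x - a) / h\<rfloor>) * h \<in> {a..<a + h}"
    by (simp add: algebra_simps)
qed

lemma eq_in_period:
  fixes h :: real
  assumes "x \<in> {a..<a + h}" "x + of_int n * h \<in> {a..<a + h}"
  shows "n = 0"
proof (rule ccontr)
  assume "n \<noteq> 0"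
  have "h > 0" using assms by auto
  have "1 \<le> \<bar>real_of_int n\<bar>" using \<open>n \<noteq> 0\<close> by linarith
  then have "h \<le> \<bar>real_of_int n\<bar> * h" using \<open>h > 0\<close> by simp
  also have "\<dots> = \<bar>of_int n * h\<bar>" using \<open>h > 0\<close> by (simp add: abs_mult)
  finally show False using assms by auto
qed

lemma measure_disjoint_finite_Union:
  assumes "finite I" "\<And>i. i \<in> I \<Longrightarrow> A i \<in> fmeasurable M" "disjoint_family_on A I"
  shows "measure M (\<Union>i\<in>I. A i) = (\<Sum>i\<in>I. measure M (A i))"
  using assms by (intro measure_finite_Union) (auto dest: fmeasurableD fmeasurableD2)

lemma half_open_interval_lmeasurable: "{x..<y::real} \<in> lmeasurable"
  by (intro bounded_set_imp_lmeasurable) (auto intro: bounded_subset[OF bounded_closed_interval])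

text \<open>Cut \<open>\<Omega>\<close> at the multiples of \<open>L\<close> and move the pieces
  into \<open>{0..<L}\<close>. Packing keeps them disjoint, and their total measure \<open>L\<close>
  makes them fill the period up to a null set. Packing also makes the representative in each orbit
  unique.\<close>

lemma fundamental_domain_if_packing:
  assumes \<Omega>: "bounded \<Omega>" "\<Omega> \<in> sets lebesgue" and L: "L = measure lebesgue \<Omega>" "L > 0"
    and packing: "\<And>x y n. x \<in> \<Omega> \<Longrightarrow> y \<in> \<Omega> \<Longrightarrow> x - y = of_int n * L \<Longrightarrow> x = y"
  shows "fundamental_domain \<Omega> L"
proof -
  have lm: "\<Omega> \<in> lmeasurable" using \<Omega> by (rule bounded_set_imp_lmeasurable)
  obtain C where C: "\<And>x. x \<in> \<Omega> \<Longrightarrow> \<bar>x\<bar> \<le> C" using \<Omega>(1) by (auto simp: bounded_iff)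
  define N where "N = \<lceil>C / L\<rceil> + 1"
  define A where "A n = \<Omega> \<inter> {of_int n * L..<(of_int n + 1) * L}" for n :: int
  define A' where "A' n = (+) (- (of_int n * L)) ` A n" for n :: int
  have A_lm: "A n \<in> lmeasurable" for n
    unfolding A_def using lm by (intro fmeasurable_Int_fmeasurable) auto
  have A'_lm: "A' n \<in> lmeasurable" for n
    unfolding A'_def by (rule measurable_translation[OF A_lm])
  have A'_iff: "y \<in> A' n \<longleftrightarrow> y \<in> {0..<L} \<and> y + of_int n * L \<in> \<Omega>" for y n
  proof -
    have "y \<in> A' n \<longleftrightarrow> y + of_int n * L \<in> A n"
    proof -
      have "y = - (of_int n * L) + x \<longleftrightarrow> x = y + of_int n * L" for x by auto
      then show ?thesis unfolding A'_def image_iff by simp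
    qed
    then show ?thesis by (simp add: A_def distrib_right conj_commute conj_left_commute)
  qed
  have \<Omega>_split: "\<Omega> = (\<Union>n\<in>{-N..N}. A n)"
  proof (intro equalityI subsetI)
    fix x assume x: "x \<in> \<Omega>"
    define n where "n = \<lfloor>x / L\<rfloor>"
    have n: "of_int n * L \<le> x" "x < (of_int n + 1) * L"
      using floor_divide_lower[OF L(2)] floor_divide_upper[OF L(2)] by (simp_all add: n_def)
    have "- (C / L) \<le> x / L" "x / L \<le> C / L"
      using C[OF x] L(2) divide_right_mono[of x C L] divide_right_mono[of "- C" x L]
      by (simp_all add: abs_le_iff)
    then have "n \<in> {-N..N}" unfolding n_def N_def atLeastAtMost_iff by linarith
    then show "x \<in> (\<Union>n\<in>{-N..N}. A n)" using n x by (auto simp: A_def)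
  qed (auto simp: A_def)
  have disj_A: "disjoint_family_on A {-N..N}"
  proof (unfold disjoint_family_on_def, intro ballI impI)
    fix m n :: int assume "m \<noteq> n"
    show "A m \<inter> A n = {}"
    proof (rule ccontr)
      assume "A m \<inter> A n \<noteq> {}"
      then obtain x where x: "of_int m * L \<le> x" "x < (of_int m + 1) * L" "of_int n * L \<le> x" "x < (of_int n + 1) * L"
        by (auto simp: A_def)
      have "(x - of_int m * L) + of_int (m - n) * L = x - of_int n * L"
        by (simp add: algebra_simps)
      with x have "x - of_int m * L \<in> {0..<0 + L}" "(x - of_int m * L) + of_int (m - n) * L \<in> {0..<0 + L}"
        by (simp_all add: distrib_right)
      from eq_in_period[OF this] \<open>m \<noteq> n\<close> show False by simp
    qed
  qed
  have disj_A': "disjoint_family_on A' {-N..N}"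
  proof (unfold disjoint_family_on_def, intro ballI impI)
    fix m n :: int assume "m \<noteq> n"
    show "A' m \<inter> A' n = {}"
    proof (rule ccontr)
      assume "A' m \<inter> A' n \<noteq> {}"
      then obtain y where y: "y + of_int m * L \<in> \<Omega>" "y + of_int n * L \<in> \<Omega>" by (auto simp: A'_iff)
      have "y + of_int m * L = y + of_int n * L"
        by (rule packing[OF y, of "m - n"]) (simp add: algebra_simps)
      then show False using \<open>m \<noteq> n\<close> L(2) by simp
    qed
  qed
  define U where "U = (\<Union>n\<in>{-N..N}. A' n)"
  have "measure lebesgue U = (\<Sum>n\<in>{-N..N}. measure lebesgue (A' n))"
    unfolding U_def using A'_lm disj_A'
    by (intro measure_disjoint_finite_Union) auto
  also have "\<dots> = (\<Sum>n\<in>{-N..N}. measure lebesgue (A n))"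
    by (simp add: A'_def measure_translation_subtract)
  also have "\<dots> = measure lebesgue \<Omega>"
    unfolding \<Omega>_split using A_lm disj_A
    by (intro measure_disjoint_finite_Union[symmetric]) auto
  finally have mU: "measure lebesgue U = L" using L by simp
  have U_lm: "U \<in> lmeasurable" unfolding U_def using A'_lm by (intro fmeasurable.finite_UN) auto
  have U_sub: "U \<subseteq> {0..<L}" by (auto simp: U_def A'_iff)
  have "measure lebesgue ({0..<L} - U) = 0"
    using measure_Diff[of lebesgue "{0..<L}" U] half_open_interval_lmeasurable U_lm U_sub L(2)
    by (simp add: mU fmeasurable_def)
  then have "negligible ({0..<L} - U)"
    using negligible_iff_measure0[of "{0..<L} - U"] fmeasurable_Diff[OF half_open_interval_lmeasurable] U_lm by auto
  \<comment> \<open>The exceptional set is the uncovered part of one period, repeated along the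
    lattice.\<close>
  then have "negligible (\<Union>k::int. (+) (of_int k * L) ` ({0..<L} - U))"
    by (intro negligible_countable_Union) (auto intro: negligible_translation)
  then have null: "(\<Union>k::int. (+) (of_int k * L) ` ({0..<L} - U)) \<in> null_sets lebesgue"
    by (simp add: negligible_iff_null_sets)
  have "((\<lambda>n::int. indicator \<Omega> (x + of_int n * L) :: real) has_sum of_nat 1) UNIV"
    if x: "x \<notin> (\<Union>k::int. (+) (of_int k * L) ` ({0..<L} - U))" for x
  proof -
    obtain m where m: "x + of_int m * L \<in> {0..<L}"
      using translate_into_period[OF L(2), of x 0] by auto
    have "x + of_int m * L \<in> U"
    proof (rule ccontr)
      assume "x + of_int m * L \<notin> U"
      then have "x \<in> (+) (of_int (- m) * L) ` ({0..<L} - U)"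
        using m by (intro image_eqI[of _ _ "x + of_int m * L"]) simp_all
      then show False using x by blast
    qed
    then obtain n where "x + of_int m * L + of_int n * L \<in> \<Omega>" by (auto simp: U_def A'_iff)
    then have mn: "x + of_int (m + n) * L \<in> \<Omega>" by (simp add: algebra_simps)
    have uniq: "k = m + n" if k: "x + of_int k * L \<in> \<Omega>" for k
    proof -
      have "x + of_int k * L = x + of_int (m + n) * L"
        by (rule packing[OF k mn, of "k - (m + n)"]) (simp add: algebra_simps)
      then show ?thesis using L(2) by (simp del: of_int_add)
    qed
    show ?thesis
    proof (rule has_sum_finite_neutralI[where B = "{m + n}"])
      show "indicator \<Omega> (x + of_int k * L) = (0 :: real)" if "k \<in> UNIV - {m + n}" for k
        using uniq[of k] that by (auto simp: indicator_def)
      show "of_nat 1 = (\<Sum>k\<in>{m + n}. indicator \<Omega> (x + of_int k * L) :: real)"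
        using mn by simp
    qed auto
  qed
  then have "AE x in lebesgue. ((\<lambda>n::int. indicator \<Omega> (x + of_int n * L) :: real) has_sum of_nat 1) UNIV"
    by (intro AE_I'[OF null]) blast
  then show ?thesis
    unfolding fundamental_domain_def lattice_multitile_def using \<Omega> L(2) by simp
qed

text \<open>A single period contains only one point of each orbit, here \<open>y\<close> itself, so
  at most the term \<open>n = 0\<close> is nonzero.\<close>

lemma has_sum_orbit:
  fixes a h y :: real
  assumes "y \<in> {a..<a + h}" "A \<subseteq> {a..<a + h}"
  shows "((\<lambda>n::int. indicator A (y + of_int n * h) :: real) has_sum indicator A y) UNIV"
proof (rule has_sum_finite_neutralI[where B = "{0}"])
  show "indicator A (y + of_int n * h) = (0::real)" if "n \<in> UNIV - {0}" for n :: int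
    using eq_in_period[OF assms(1), of n] assms(2) that by (auto simp: indicator_def)
qed auto

lemma has_sum_lattice_shift:
  fixes h x :: real and m :: int
  shows "((\<lambda>n::int. f (x + of_int m * h + of_int n * h)) has_sum c) UNIV \<longleftrightarrow>
    ((\<lambda>n::int. f (x + of_int n * h)) has_sum c) UNIV"
proof -
  have "bij_betw (\<lambda>n. n + m) (UNIV :: int set) UNIV"
    by (rule bij_betwI[where g = "\<lambda>n. n - m"]) auto
  from has_sum_reindex_bij_betw[OF this, of "\<lambda>n. f (x + of_int n * h)" c]
  show ?thesis by (simp add: algebra_simps)
qed

lemma has_sum_interval:
  fixes a h x :: real
  assumes "h > 0"
  shows "((\<lambda>n::int. indicator {a..<a + h} (x + of_int n * h) :: real) has_sum 1) UNIV"
proof -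
  obtain m :: int where m: "x + of_int m * h \<in> {a..<a + h}"
    using translate_into_period[OF assms] .
  show ?thesis
    using has_sum_orbit[OF m subset_refl] m
    by (simp add: has_sum_lattice_shift[of "indicator {a..<a + h}"])
qed

text \<open>Too short an interval leaves an open gap after \<open>b\<close>, and too long a one
  covers an open set next to \<open>a\<close> at least twice; an almost everywhere statement is
  refuted on either.\<close>

lemma fundamental_domain_interval_iff:
  assumes "a < b"
  shows "fundamental_domain {a..<b} h \<longleftrightarrow> b - a = h"
proof
  assume "b - a = h"
  then have "h > 0" "{a..<b} = {a..<a + h}" using assms by auto
  then show "fundamental_domain {a..<b} h"
    unfolding fundamental_domain_def lattice_multitile_def
    using has_sum_interval[OF \<open>h > 0\<close>, of a] by (auto intro: bounded_subset[OF bounded_closed_interval])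
next
  let ?P = "\<lambda>x. ((\<lambda>n::int. indicator {a..<b} (x + of_int n * h) :: real) has_sum 1) UNIV"
  assume "fundamental_domain {a..<b} h"
  then have "h > 0" and ae: "AE x in lebesgue. ?P x"
    unfolding fundamental_domain_def lattice_multitile_def by auto
  have ex: "\<exists>x. u < x \<and> x < v \<and> ?P x" if "u < v" for u v
  proof (rule ccontr)
    assume "\<not> ?thesis"
    then have sub: "{u<..<v} \<subseteq> {x. \<not> ?P x}" by auto
    from ae obtain N where "{x. \<not> ?P x} \<subseteq> N" "N \<in> null_sets lebesgue"
      by (auto elim!: AE_E simp: null_sets_def)
    with sub have "negligible {u<..<v}"
      by (meson negligible_iff_null_sets negligible_subset subset_trans)
    then show False using open_not_negligible[of "{u<..<v}"] that by auto
  qed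
  consider "b - a < h" | "b - a = h" | "b - a > h" by linarith
  then show "b - a = h"
  proof cases
    case 1
    then obtain x where x: "b < x" "x < a + h" "?P x" using ex[of b "a + h"] by auto
    have "((\<lambda>n::int. indicator {a..<b} (x + of_int n * h) :: real) has_sum indicator {a..<b} x) UNIV"
      by (rule has_sum_orbit[where a = a]) (use x 1 assms in auto)
    then show ?thesis using has_sum_unique[OF x(3)] x by fastforce
  next
    case 3
    then obtain x where x: "a < x" "x < b - h" "?P x" using ex[of a "b - h"] by auto
    have "(\<Sum>n\<in>{0, 1::int}. indicator {a..<b} (x + of_int n * h) :: real) \<le> 1"
      by (rule finite_sum_le_has_sum[OF x(3)]) auto
    then show ?thesis using x \<open>h > 0\<close> by simp
  qed simp
qed

section \<open>Arcs on the circle and multitiles built from three intervals\<close>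

lemma circle_proj_shift: "circle_proj h (x + of_int n * h) = circle_proj h x"
proof -
  have "[x + of_int n * h = x] (rmod h)"
    unfolding rcong_altdef by (rule exI[of _ "- n"]) simp
  then show ?thesis
    unfolding circle_proj_def using rcong_trans rcong_sym by blast
qed

lemma circle_proj_eqD:
  assumes "circle_proj h x = circle_proj h y" "\<bar>x - y\<bar> < h"
  shows "x = y"
proof -
  have "y \<in> circle_proj h x" unfolding assms(1) by (simp add: circle_proj_def)
  then obtain n where n: "y = x + of_int n * h" unfolding circle_proj_def rcong_altdef by auto
  have "n = 0"
    using eq_in_period[of x "min x y" h n] assms(2) n by auto
  then show ?thesis using n by simp
qed

text \<open>The contributions \<open>u\<close>, \<open>v\<close>, \<open>w\<close> of the three sets
  may vary with the orbit; only their total is fixed. This accommodates two sets that share each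
  period between them.\<close>

lemma lattice_multitile_union3:
  assumes disj: "A \<inter> B = {}" "A \<inter> C = {}" "B \<inter> C = {}"
    and "h > 0" "k > 0" "bounded (A \<union> B \<union> C)" "A \<union> B \<union> C \<in> sets lebesgue"
    and sums: "\<And>x. \<exists>u v w. ((\<lambda>n::int. indicator A (x + of_int n * h) :: real) has_sum u) UNIV \<and>
      ((\<lambda>n::int. indicator B (x + of_int n * h) :: real) has_sum v) UNIV \<and>
      ((\<lambda>n::int. indicator C (x + of_int n * h) :: real) has_sum w) UNIV \<and> u + v + w = real k"
  shows "lattice_multitile k (A \<union> B \<union> C) h"
proof -
  have split: "indicator (A \<union> B \<union> C) y = (indicator A y + indicator B y + indicator C y :: real)" for y
    using disj by (auto simp: indicator_def)
  have "((\<lambda>n::int. indicator (A \<union> B \<union> C) (x + of_int n * h) :: real) has_sum of_nat k) UNIV" for x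
  proof -
    obtain u v w where "((\<lambda>n::int. indicator A (x + of_int n * h) :: real) has_sum u) UNIV"
      "((\<lambda>n::int. indicator B (x + of_int n * h) :: real) has_sum v) UNIV"
      "((\<lambda>n::int. indicator C (x + of_int n * h) :: real) has_sum w) UNIV" "u + v + w = real k"
      using sums by blast
    from has_sum_add[OF has_sum_add[OF this(1,2)] this(3)] this(4) show ?thesis
      unfolding split by simp
  qed
  then show ?thesis using assms by (simp add: lattice_multitile_def)
qed

lemma lattice_multitile_equal_lengths:
  assumes "a < b" "c < d" "e < f" and disj: "{a..<b} \<inter> {c..<d} = {}" "{a..<b} \<inter> {e..<f} = {}" "{c..<d} \<inter> {e..<f} = {}"
    and len: "b - a = h" "d - c = h" "f - e = h"
  shows "lattice_multitile 3 ({a..<b} \<union> {c..<d} \<union> {e..<f}) h"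
proof (rule lattice_multitile_union3[OF disj])
  have "h > 0" and eqs: "b = a + h" "d = c + h" "f = e + h" using assms by auto
  then show "h > 0" by simp
  show "\<exists>u v w. ((\<lambda>n::int. indicator {a..<b} (x + of_int n * h) :: real) has_sum u) UNIV \<and>
      ((\<lambda>n::int. indicator {c..<d} (x + of_int n * h) :: real) has_sum v) UNIV \<and>
      ((\<lambda>n::int. indicator {e..<f} (x + of_int n * h) :: real) has_sum w) UNIV \<and> u + v + w = real 3" for x
    unfolding eqs using has_sum_interval[OF \<open>h > 0\<close>, of _ x]
    by (intro exI[of _ "1 :: real"] conjI) simp_all
qed (auto intro: bounded_subset[OF bounded_closed_interval])

text \<open>Translation by \<open>of_int n * h\<close> carries \<open>{c..<d}\<close> to
  \<open>{b..<a + h}\<close>, so modulo \<open>h\<close> the first two intervals fill the period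
  starting at \<open>a\<close> exactly, and the third interval is a period itself.\<close>

lemma two_arcs_and_interval:
  assumes "a < b" "c < d" "e < f" and disj: "{a..<b} \<inter> {c..<d} = {}" "{a..<b} \<inter> {e..<f} = {}" "{c..<d} \<inter> {e..<f} = {}"
    and len: "f - e = h" "h = (b - a) + (d - c)" and n: "b - c = of_int n * h"
  defines "A \<equiv> circle_proj h ` {a..<b}" and "B \<equiv> circle_proj h ` {c..<d}"
  shows "[b = c] (rmod h)" "adjacent_half_open_arcs h A B" "partition_circle h A B"
    "lattice_multitile 2 ({a..<b} \<union> {c..<d} \<union> {e..<f}) h"
proof -
  have "h > 0" and bh: "b < a + h" using len(2) \<open>a < b\<close> \<open>c < d\<close> by linarith+
  have eqs: "b = c + of_int n * h" "f = e + h" and dh: "d + of_int n * h = a + h"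
    using len n by linarith+
  show "[b = c] (rmod h)"
    unfolding rcong_altdef by (rule exI[of _ "- n"]) (simp add: eqs)
  have cd: "{b..<a + h} = (\<lambda>x. x + of_int n * h) ` {c..<d}"
    unfolding image_add_atLeastLessThan' dh eqs(1) ..
  have B: "B = circle_proj h ` {b..<a + h}"
    unfolding cd B_def image_image circle_proj_shift ..
  show "adjacent_half_open_arcs h A B"
    unfolding adjacent_half_open_arcs_def A_def B
  proof (intro exI conjI)
    show "a < b" "b < a + h" by fact+
  qed simp_all
  have "A \<inter> B = {}"
  proof -
    have "u = v" if "circle_proj h u = circle_proj h v" "u \<in> {a..<b}" "v \<in> {b..<a + h}" for u v
      using that by (intro circle_proj_eqD[of h]) auto
    then show ?thesis unfolding A_def B by fastforce
  qed
  moreover have "circle h - (A \<union> B) = {}"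
  proof -
    have "circle_proj h x \<in> A \<union> B" for x
    proof -
      obtain m where "x + of_int m * h \<in> {a..<a + h}" using translate_into_period[OF \<open>h > 0\<close>] .
      then have "x + of_int m * h \<in> {a..<b} \<union> {b..<a + h}" using \<open>a < b\<close> bh by auto
      then have "circle_proj h (x + of_int m * h) \<in> A \<union> B" unfolding A_def B by blast
      then show ?thesis by (simp add: circle_proj_shift)
    qed
    then show ?thesis unfolding circle_def by blast
  qed
  moreover have "circle_null h {}" by (simp add: circle_null_def)
  moreover have "A \<subseteq> circle h" "B \<subseteq> circle h" by (auto simp: A_def B_def circle_def)
  ultimately show "partition_circle h A B"
    unfolding partition_circle_def by (simp only: simp_thms)
  show "lattice_multitile 2 ({a..<b} \<union> {c..<d} \<union> {e..<f}) h"
  proof (rule lattice_multitile_union3[OF disj \<open>h > 0\<close>])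
    fix x
    obtain m where m: "x + of_int m * h \<in> {a..<a + h}" using translate_into_period[OF \<open>h > 0\<close>] .
    let ?y = "x + of_int m * h"
    have "((\<lambda>k::int. indicator {a..<b} (?y + of_int k * h) :: real) has_sum indicator {a..<b} ?y) UNIV"
      by (rule has_sum_orbit[OF m]) (use bh in auto)
    then have 1: "((\<lambda>k::int. indicator {a..<b} (x + of_int k * h) :: real) has_sum indicator {a..<b} ?y) UNIV"
      by (subst (asm) has_sum_lattice_shift)
    have "((\<lambda>k::int. indicator {b..<a + h} (?y + of_int k * h) :: real) has_sum indicator {b..<a + h} ?y) UNIV"
      by (rule has_sum_orbit[OF m]) (use \<open>a < b\<close> in auto)
    then have "((\<lambda>k::int. indicator {b..<a + h} (x + of_int k * h) :: real) has_sum indicator {b..<a + h} ?y) UNIV"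
      by (subst (asm) has_sum_lattice_shift)
    \<comment> \<open>Starting the orbit \<open>n\<close> steps later leaves its sum unchanged and
      turns the indicator of the moved arc into that of \<open>{c..<d}\<close>.\<close>
    then have "((\<lambda>k::int. indicator {b..<a + h} (x + of_int n * h + of_int k * h) :: real) has_sum indicator {b..<a + h} ?y) UNIV"
      by (subst has_sum_lattice_shift)
    moreover have "indicator {b..<a + h} (x + of_int n * h + of_int k * h) = (indicator {c..<d} (x + of_int k * h) :: real)" for k
      unfolding eqs(1) dh[symmetric] by (simp add: indicator_def)
    ultimately have 2: "((\<lambda>k::int. indicator {c..<d} (x + of_int k * h) :: real) has_sum indicator {b..<a + h} ?y) UNIV"
      by simp
    have 3: "((\<lambda>k::int. indicator {e..<f} (x + of_int k * h) :: real) has_sum 1) UNIV"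
      unfolding eqs(2) by (rule has_sum_interval[OF \<open>h > 0\<close>])
    have "indicator {a..<b} ?y + indicator {b..<a + h} ?y + 1 = real 2"
      using m by (auto simp: indicator_def)
    with 1 2 3 show "\<exists>u v w. ((\<lambda>n::int. indicator {a..<b} (x + of_int n * h) :: real) has_sum u) UNIV \<and>
      ((\<lambda>n::int. indicator {c..<d} (x + of_int n * h) :: real) has_sum v) UNIV \<and>
      ((\<lambda>n::int. indicator {e..<f} (x + of_int n * h) :: real) has_sum w) UNIV \<and> u + v + w = real 2"
      by blast
  qed (auto intro: bounded_subset[OF bounded_closed_interval])
qed

section \<open>Relabeling and the three alternatives\<close>

lemma ex_permutation_of_three:
  assumes "{1, 2, 3} = {p, q, r}" "distinct [p, q, r :: nat]"
  shows "\<exists>\<sigma>. \<sigma> permutes {1, 2, 3} \<and> \<sigma> 1 = p \<and> \<sigma> 2 = q \<and> \<sigma> 3 = r"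
proof -
  define \<sigma> where "\<sigma> = (\<lambda>i::nat. if i = 1 then p else if i = 2 then q else if i = 3 then r else i)"
  have \<sigma>: "\<sigma> 1 = p" "\<sigma> 2 = q" "\<sigma> 3 = r" by (simp_all add: \<sigma>_def)
  then have "\<sigma> ` {1, 2, 3} = {1, 2, 3}" unfolding assms(1)[symmetric] image_insert image_empty
    using assms(1) by simp
  moreover have "inj_on \<sigma> {1, 2, 3}" using assms(2) by (auto simp: inj_on_def \<sigma>_def)
  ultimately have "\<sigma> permutes {1, 2, 3}"
    by (intro bij_imp_permutes) (auto simp: bij_betw_def \<sigma>_def)
  with \<sigma> show ?thesis by blast
qed

theorem theorem1p2:
  fixes a b len :: "nat \<Rightarrow> real" and L :: real and \<Omega> :: "real set"
  assumes "\<And>j. j \<in> {1, 2, 3} \<Longrightarrow> a j < b j"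
    and "disjoint_family_on (\<lambda>j. {a j..<b j}) {1, 2, 3}"
    and "\<Omega> = {a 1..<b 1} \<union> {a 2..<b 2} \<union> {a 3..<b 3}"
    and "components \<Omega> = {{a 1..<b 1}, {a 2..<b 2}, {a 3..<b 3}}"
    and "spectral \<Omega>"
    and "\<And>j. j \<in> {1, 2, 3} \<Longrightarrow> len j = b j - a j"
    and "L = len 1 + len 2 + len 3"
  shows
    "(\<exists>\<sigma>. \<sigma> permutes {1, 2, 3} \<and>
       (fundamental_domain \<Omega> L
        \<or>
        (\<exists>h. len (\<sigma> 1) = h \<and> len (\<sigma> 2) = h \<and> len (\<sigma> 3) = h \<and> h = L / 3 \<and>
           (\<forall>j\<in>{1, 2, 3}. fundamental_domain {a (\<sigma> j)..<b (\<sigma> j)} h) \<and>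
           lattice_multitile 3 \<Omega> h)
        \<or>
        (\<exists>h. len (\<sigma> 3) = len (\<sigma> 1) + len (\<sigma> 2) \<and> len (\<sigma> 3) = h \<and> h = L / 2 \<and>
           [b (\<sigma> 1) = a (\<sigma> 2)] (rmod h) \<and>
           adjacent_half_open_arcs h
             (circle_proj h ` {a (\<sigma> 1)..<b (\<sigma> 1)}) (circle_proj h ` {a (\<sigma> 2)..<b (\<sigma> 2)}) \<and>
           partition_circle h
             (circle_proj h ` {a (\<sigma> 1)..<b (\<sigma> 1)}) (circle_proj h ` {a (\<sigma> 2)..<b (\<sigma> 2)}) \<and>
           fundamental_domain {a (\<sigma> 3)..<b (\<sigma> 3)} h \<and>
           lattice_multitile 2 \<Omega> h)))
     \<and>
     (\<forall>h. (len 1 = h \<and> len 2 = h \<and> len 3 = h \<and> h = L / 3) \<longleftrightarrow>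
        ((\<forall>j\<in>{1, 2, 3}. fundamental_domain {a j..<b j} h) \<and> lattice_multitile 3 \<Omega> h))"
proof -
  let ?K = "{1, 2, 3 :: nat}"
  have less: "a j < b j" if "j \<in> ?K" for j using assms(1) that .
  note len = assms(6)
  have \<Omega>_eq: "\<Omega> = (\<Union>j\<in>?K. {a j..<b j})" using assms(3) by auto
  have L_sum: "L = (\<Sum>j\<in>?K. b j - a j)" using assms(7) len by simp
  have lm: "\<Omega> \<in> lmeasurable" and bdd: "bounded \<Omega>" and meas: "\<Omega> \<in> sets lebesgue"
    using assms(5) by (auto simp: spectral_def intro: bounded_set_imp_lmeasurable)
  have "measure lebesgue (\<Union>j\<in>?K. {a j..<b j}) = (\<Sum>j\<in>?K. measure lebesgue {a j..<b j})"
    by (rule measure_disjoint_finite_Union) (use assms(2) half_open_interval_lmeasurable in auto)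
  also have "\<dots> = L" unfolding L_sum using less by (intro sum.cong) force+
  finally have L: "L = measure lebesgue \<Omega>" by (simp add: \<Omega>_eq)
  have L_pos: "L > 0" using assms(5) L by (simp add: spectral_def)
  obtain \<Lambda> where "L2_orthonormal_basis \<Omega> \<Lambda> (\<lambda>\<xi> x. of_real (L powr (-1/2)) * chr \<xi> x)"
    using assms(5) unfolding spectral_def exp_eq_chr L[symmetric] by blast
  then interpret interval_spectrum \<Omega> \<Lambda> L ?K a b
    by unfold_locales (use lm L L_pos less assms(2) \<Omega>_eq in auto)
  have disj: "{a i..<b i} \<inter> {a j..<b j} = {}" if "i \<in> ?K" "j \<in> ?K" "i \<noteq> j" for i j
    using disjoint_family_onD[OF assms(2) that] .
  have equal_lengths: "(\<forall>j\<in>?K. fundamental_domain {a j..<b j} h) \<and> lattice_multitile 3 \<Omega> h"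
    if "\<forall>j\<in>?K. b j - a j = h" for h
  proof
    show "\<forall>j\<in>?K. fundamental_domain {a j..<b j} h"
      using that fundamental_domain_interval_iff[OF less] by blast
    show "lattice_multitile 3 \<Omega> h"
      unfolding assms(3) by (rule lattice_multitile_equal_lengths[OF less less less disj disj disj])
        (use that in simp_all)
  qed
  have "card ?K = 3" by simp
  from three_interval_classification[OF this L_sum]
  consider (one) \<kappa> where "\<forall>\<xi>\<in>\<Lambda>. chr L \<xi> = \<kappa>" | (three) h where "\<forall>j\<in>?K. b j - a j = h"
    | (two) p q r n where "?K = {p, q, r}" "distinct [p, q, r]" "b r - a r = b p - a p + (b q - a q)"
        "b p - a q = of_int n * (b r - a r)"
    by blast
  then have "\<exists>\<sigma>. \<sigma> permutes {1, 2, 3} \<and>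
       (fundamental_domain \<Omega> L
        \<or>
        (\<exists>h. len (\<sigma> 1) = h \<and> len (\<sigma> 2) = h \<and> len (\<sigma> 3) = h \<and> h = L / 3 \<and>
           (\<forall>j\<in>{1, 2, 3}. fundamental_domain {a (\<sigma> j)..<b (\<sigma> j)} h) \<and>
           lattice_multitile 3 \<Omega> h)
        \<or>
        (\<exists>h. len (\<sigma> 3) = len (\<sigma> 1) + len (\<sigma> 2) \<and> len (\<sigma> 3) = h \<and> h = L / 2 \<and>
           [b (\<sigma> 1) = a (\<sigma> 2)] (rmod h) \<and>
           adjacent_half_open_arcs h
             (circle_proj h ` {a (\<sigma> 1)..<b (\<sigma> 1)}) (circle_proj h ` {a (\<sigma> 2)..<b (\<sigma> 2)}) \<and>
           partition_circle h
             (circle_proj h ` {a (\<sigma> 1)..<b (\<sigma> 1)}) (circle_proj h ` {a (\<sigma> 2)..<b (\<sigma> 2)}) \<and>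
           fundamental_domain {a (\<sigma> 3)..<b (\<sigma> 3)} h \<and>
           lattice_multitile 2 \<Omega> h))"
    (is "\<exists>\<sigma>. _ \<and> (?i \<or> ?ii \<sigma> \<or> ?iii \<sigma>)")
  proof cases
    case one
    \<comment> \<open>A constant character \<open>chr L\<close> makes the translates of
      \<open>\<Omega>\<close> by multiples of \<open>L\<close> disjoint, and the measure
      \<open>L\<close> turns this packing into a tiling.\<close>
    have "fundamental_domain \<Omega> L"
      using lattice_packing[OF one] by (intro fundamental_domain_if_packing bdd meas L L_pos)
    then show ?thesis using permutes_id by blast
  next
    case three
    then have "len 1 = h" "len 2 = h" "len 3 = h" using len by simp_all
    moreover from this have "h = L / 3" using assms(7) by simp
    ultimately have "?ii id" using equal_lengths[OF three] unfolding id_apply by blast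
    then show ?thesis using permutes_id by blast
  next
    case two
    have K: "p \<in> ?K" "q \<in> ?K" "r \<in> ?K" using two(1) by auto
    obtain \<sigma> where \<sigma>: "\<sigma> permutes ?K" "\<sigma> 1 = p" "\<sigma> 2 = q" "\<sigma> 3 = r"
      using ex_permutation_of_three[OF two(1,2)] by blast
    define h where "h = b r - a r"
    have "L = b p - a p + (b q - a q) + (b r - a r)"
      using two(2) unfolding L_sum two(1) by simp
    then have "h = L / 2" using two(3) by (simp add: h_def)
    have \<Omega>: "\<Omega> = {a p..<b p} \<union> {a q..<b q} \<union> {a r..<b r}"
      unfolding \<Omega>_eq two(1) by auto
    have neq: "p \<noteq> q" "p \<noteq> r" "q \<noteq> r" using two(2) by simp_all
    have h: "h = b p - a p + (b q - a q)" "b p - a q = of_int n * h"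
      using two(3,4) unfolding h_def .
    note arcs = two_arcs_and_interval[OF less[OF K(1)] less[OF K(2)] less[OF K(3)]
        disj[OF K(1,2) neq(1)] disj[OF K(1,3) neq(2)] disj[OF K(2,3) neq(3)] h_def[symmetric] h]
    have "len r = h" "len r = len p + len q"
      using two(3) by (simp_all only: len[OF K(1)] len[OF K(2)] len[OF K(3)] h_def)
    moreover have "fundamental_domain {a r..<b r} h"
      using fundamental_domain_interval_iff[OF less[OF K(3)]] h_def by blast
    ultimately have "?iii \<sigma>"
      unfolding \<sigma>(2-4) \<Omega> using arcs \<open>h = L / 2\<close> by blast
    then show ?thesis using \<sigma>(1) by blast
  qed
  \<comment> \<open>Both sides are symmetric in the three intervals, so the equivalence is proved
    for the original labels.\<close>
  moreover have "(len 1 = h \<and> len 2 = h \<and> len 3 = h \<and> h = L / 3) \<longleftrightarrow>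
        ((\<forall>j\<in>{1, 2, 3}. fundamental_domain {a j..<b j} h) \<and> lattice_multitile 3 \<Omega> h)" for h
  proof
    assume "len 1 = h \<and> len 2 = h \<and> len 3 = h \<and> h = L / 3"
    then have "len j = h" if "j \<in> ?K" for j using that by blast
    then have "\<forall>j\<in>?K. b j - a j = h" using len by metis
    then show "(\<forall>j\<in>{1, 2, 3}. fundamental_domain {a j..<b j} h) \<and> lattice_multitile 3 \<Omega> h"
      by (rule equal_lengths)
  next
    assume "(\<forall>j\<in>{1, 2, 3}. fundamental_domain {a j..<b j} h) \<and> lattice_multitile 3 \<Omega> h"
    then have "len j = h" if "j \<in> ?K" for j
      using fundamental_domain_interval_iff[OF less[OF that]] len[OF that] that by auto
    then have "len 1 = h" "len 2 = h" "len 3 = h" by simp_all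
    then show "len 1 = h \<and> len 2 = h \<and> len 3 = h \<and> h = L / 3" using assms(7) by linarith
  qed
  ultimately show ?thesis by blast
qed

end
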